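(* Let $r$ be a positive integer. For $-1\le j\le r-1$, \begin{align*} \Phi^t_{j}(z) & = \frac{1}{1-(x_1 + t x_2) - t \sum_{i=0}^{r-1}(x_{r+2-i} - x_1 x_{r+1-i}) }\\ & \quad \times \sum_{i=0}^{r-1-j} \widetilde{A^{(j)}_i} B_i z^{i+1}\, {}_{r+2}\phi_{r+1}\left[ \begin{array}{c} q^{i+1}, a_1q^i, \ldots, a_{r+1}q^i \\ b_1q^i, \ldots, b_{r+1}q^i \end{array} ; q, \frac{b_1 \cdots b_{r+1}}{q^{r+1} a_1 \cdots a_{r+1}} z \right] +\delta_{j, -1}, \end{align*} where $\widetilde{A^{(j)}_i} = \sum_{m=i}^{r-1-j} (x_{r+2-m} -x_1 x_{r+1-m}) S_q(m+1, i+1) + x_1 x_{j+2} S_q(r-j, i+1)$ for $0\le i\le r-1-j$, and $B_i=\frac{(q, a_1, \ldots, a_{r+1}; q)_i}{(b_1, \ldots, b_{r+1}; q)_i} \left(\frac{b_1 \cdots b_{r+1}}{q^{r+1} (1-q) a_1 \cdots a_{r+1}} \right)^i$.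
   Context: $q$ is a formal parameter, $[n]=(1-q^n)/(1-q)$. For an index $\mathbf k=(k_1,\dots,k_l)$ of positive integers, $Li_{\mathbf k;q}(z)=\sum_{m_1>\cdots>m_l\ge1}\frac{z^{m_1}}{[m_1]^{k_1}\cdots[m_l]^{k_l}}$, $Li^t_{\mathbf k;q}(z)=\sum_{\mathbf p}Li_{\mathbf p;q}(z)t^{l-\mathrm{dep}(\mathbf p)}$, $\mathbf p$ running over indices $(k_1\,\square\cdots\square\,k_l)$ with each $\square$ filled by ``$,$'' or ``$+$''. The $i$-height is $\#\{j:k_j\ge i+1\}$. For $k,l,h_1,\dots,h_r\ge0$ and $-1\le j\le r-1$, $I_j(k,l,h_1,\dots,h_r)$ is the set of indices of weight $k$, depth $l$, $i$-height $h_i$ with $k_1\ge j+2$; $G^t_j=\sum_{\mathbf k\in I_j}Li^t_{\mathbf k;q}(z)$ (empty sum $0$), $G^t(0,\dots,0;z):=1$ for $j=-1$. For variables $x_1,\dots,x_{r+2}$, $\Phi^t_j(z)=\sum_{k,l,h_i\ge0}G^t_j(k,l,h_1,\dots,h_r;z)x_1^{k-l-\sum_i h_i}x_2^{l-h_1}x_3^{h_1-h_2}\cdots x_{r+1}^{h_{r-1}-h_r}x_{r+2}^{h_r}$. $\alpha_1,\dots,\alpha_{r+1}$: $\sum_i\alpha_i=(1-t)x_2-x_1$, $e_j(\alpha)=(1-t)(x_{j+1}-x_1x_j)$ ($j=2,\dots,r+1$); $\beta_1,\dots,\beta_{r+1}$: $\sum_i\beta_i=-(x_1+tx_2)$, $e_j(\beta)=-t(x_{j+1}-x_1x_j)$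 ($j=2,\dots,r+1$), $e_j$ elementary symmetric; $a_i=q/(1+(1-q)\alpha_i)$, $b_i=q^2/(1+(1-q)\beta_i)$. $(a;q)_n=\prod_{i=0}^{n-1}(1-aq^i)$, $(a_1,\dots,a_m;q)_n=\prod_i(a_i;q)_n$, ${}_{s+1}\phi_s$ the basic hypergeometric series $\sum_{n\ge0}\frac{(a_1,\dots,a_{s+1};q)_n}{(q,b_1,\dots,b_s;q)_n}w^n$. $S_q$: $S_q(0,0)=1$, $S_q(n,k)=q^{k-1}S_q(n-1,k-1)+[k]S_q(n-1,k)$ for $0<k\le n$, $0$ otherwise. *)

theory Defs
  imports
    "HOL-Library.Poly_Mapping"
    "HOL-Computational_Algebra.Formal_Power_Series"
begin

section \<open>Multivariate formal power series\<close>

text \<open>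
  Formal power series in commuting variables indexed by natural numbers: an arbitrary assignment
  of coefficients to monomials, a monomial being given by its finitely supported exponent function.
  Having infinitely many variables available lets the number of variables depend on a natural number.
\<close>

typedef 'a mfps = "UNIV :: ((nat \<Rightarrow>\<^sub>0 nat) \<Rightarrow> 'a) set"
  morphisms mfps_nth Abs_mfps ..

lemma mfps_nth_Abs [simp]: "mfps_nth (Abs_mfps f) = f"
  by (simp add: Abs_mfps_inverse)

lemma mfps_eqI: "(\<And>\<nu>. mfps_nth f \<nu> = mfps_nth g \<nu>) \<Longrightarrow> f = g"
  by (metis ext mfps_nth_inject)

definition splits :: "(nat \<Rightarrow>\<^sub>0 nat) \<Rightarrow> ((nat \<Rightarrow>\<^sub>0 nat) \<times> (nat \<Rightarrow>\<^sub>0 nat)) set" where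
  "splits \<nu> = {(\<mu>, \<rho>). \<mu> + \<rho> = \<nu>}"

lemma finite_splits [simp, intro]: "finite (splits \<nu>)"
proof -
  let ?F = "{f :: nat \<Rightarrow> nat. \<forall>i. (i \<in> Poly_Mapping.keys \<nu> \<longrightarrow> f i \<in> {..\<Sum>i\<in>Poly_Mapping.keys \<nu>. Poly_Mapping.lookup \<nu> i}) \<and>
              (i \<notin> Poly_Mapping.keys \<nu> \<longrightarrow> f i = 0)}"
  have "finite ?F"
    by (rule finite_set_of_finite_funs) auto
  moreover have "Poly_Mapping.lookup \<mu> \<in> ?F" if "\<mu> + \<rho> = \<nu>" for \<mu> \<rho>
  proof -
    have le: "Poly_Mapping.lookup \<mu> i \<le> Poly_Mapping.lookup \<nu> i" for i
      using that by (auto simp: lookup_add)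
    have "Poly_Mapping.lookup \<nu> i \<le> (\<Sum>i\<in>Poly_Mapping.keys \<nu>. Poly_Mapping.lookup \<nu> i)" if "i \<in> Poly_Mapping.keys \<nu>" for i
      using that by (intro member_le_sum) auto
    moreover have "Poly_Mapping.lookup \<mu> i = 0" if "i \<notin> Poly_Mapping.keys \<nu>" for i
      using le[of i] that by (simp add: in_keys_iff)
    ultimately show ?thesis
      using le by (auto intro: order_trans)
  qed
  ultimately have "finite (Poly_Mapping.lookup ` {\<mu>. \<exists>\<rho>. \<mu> + \<rho> = \<nu>})"
    by (auto elim!: finite_subset[rotated])
  then have fin: "finite {\<mu>. \<exists>\<rho>. \<mu> + \<rho> = \<nu>}"
    by (rule finite_imageD) (auto simp: inj_on_def lookup_inject)
  show ?thesis
  proof (rule finite_subset)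
    show "splits \<nu> \<subseteq> (\<lambda>\<mu>. (\<mu>, \<nu> - \<mu>)) ` {\<mu>. \<exists>\<rho>. \<mu> + \<rho> = \<nu>}"
      by (auto simp: splits_def image_iff)
  qed (use fin in simp)
qed

instantiation mfps :: (comm_ring_1) comm_ring_1
begin

definition zero_mfps where "0 = Abs_mfps (\<lambda>_. 0)"
definition one_mfps where "1 = Abs_mfps (\<lambda>\<nu>. if \<nu> = 0 then 1 else 0)"
definition plus_mfps where "f + g = Abs_mfps (\<lambda>\<nu>. mfps_nth f \<nu> + mfps_nth g \<nu>)"
definition minus_mfps where "f - g = Abs_mfps (\<lambda>\<nu>. mfps_nth f \<nu> - mfps_nth g \<nu>)"
definition uminus_mfps where "- f = Abs_mfps (\<lambda>\<nu>. - mfps_nth f \<nu>)"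
definition times_mfps where
  "f * g = Abs_mfps (\<lambda>\<nu>. \<Sum>(\<mu>, \<rho>)\<in>splits \<nu>. mfps_nth f \<mu> * mfps_nth g \<rho>)"

instance
proof
  fix f g h :: "'a mfps"
  show "f * g * h = f * (g * h)"
  proof (rule mfps_eqI)
    fix \<nu>
    have "mfps_nth (f * g * h) \<nu> =
        (\<Sum>((\<mu>, \<rho>), (\<sigma>, \<tau>))\<in>Sigma (splits \<nu>) (\<lambda>(\<mu>, \<rho>). splits \<mu>).
           mfps_nth f \<sigma> * mfps_nth g \<tau> * mfps_nth h \<rho>)"
      by (simp add: times_mfps_def sum_distrib_right case_prod_unfold sum.Sigma)
    also have "\<dots> =
        (\<Sum>((\<mu>, \<rho>), (\<sigma>, \<tau>))\<in>Sigma (splits \<nu>) (\<lambda>(\<mu>, \<rho>). splits \<rho>).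
           mfps_nth f \<mu> * mfps_nth g \<sigma> * mfps_nth h \<tau>)"
      by (rule sum.reindex_bij_witness
          [where i = "\<lambda>((\<mu>, \<rho>), (\<sigma>, \<tau>)). ((\<mu> + \<sigma>, \<tau>), (\<mu>, \<sigma>))"
             and j = "\<lambda>((\<mu>, \<rho>), (\<sigma>, \<tau>)). ((\<sigma>, \<tau> + \<rho>), (\<tau>, \<rho>))"])
         (auto simp: splits_def add.assoc)
    also have "\<dots> = mfps_nth (f * (g * h)) \<nu>"
      by (simp add: times_mfps_def sum_distrib_left case_prod_unfold sum.Sigma mult.assoc)
    finally show "mfps_nth (f * g * h) \<nu> = mfps_nth (f * (g * h)) \<nu>" .
  qed
  show "f * g = g * f"
  proof (rule mfps_eqI)
    fix \<nu>
    show "mfps_nth (f * g) \<nu> = mfps_nth (g * f) \<nu>"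
      unfolding times_mfps_def mfps_nth_Abs
      by (rule sum.reindex_bij_witness[where i = prod.swap and j = prod.swap])
         (auto simp: splits_def add.commute mult.commute)
  qed
  show "1 * f = f"
  proof (rule mfps_eqI)
    fix \<nu>
    have "mfps_nth (1 * f) \<nu> =
        (\<Sum>p\<in>splits \<nu>. if p = (0, \<nu>) then mfps_nth f \<nu> else 0)"
      unfolding times_mfps_def one_mfps_def mfps_nth_Abs
      by (rule sum.cong) (auto simp: splits_def split: if_splits)
    also have "\<dots> = mfps_nth f \<nu>"
      using finite_splits[of \<nu>] by (subst sum.delta) (auto simp: splits_def)
    finally show "mfps_nth (1 * f) \<nu> = mfps_nth f \<nu>" .
  qed
  show "(f + g) * h = f * h + g * h"
    by (rule mfps_eqI)
       (simp add: times_mfps_def plus_mfps_def case_prod_unfold distrib_right sum.distrib)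
  show "f + g + h = f + (g + h)" "f + g = g + f" "0 + f = f" "- f + f = 0" "f - g = f + - g"
    by (auto intro!: mfps_eqI
        simp: plus_mfps_def zero_mfps_def uminus_mfps_def minus_mfps_def add.assoc add.commute)
  have "mfps_nth (0 :: 'a mfps) 0 \<noteq> mfps_nth 1 0"
    by (simp add: zero_mfps_def one_mfps_def)
  then show "(0 :: 'a mfps) \<noteq> 1" by metis
qed

end

definition mfps_const :: "'a::zero \<Rightarrow> 'a mfps" where
  "mfps_const c = Abs_mfps (\<lambda>\<nu>. if \<nu> = 0 then c else 0)"

definition mfps_var :: "nat \<Rightarrow> 'a::zero_neq_one mfps" where
  "mfps_var i = Abs_mfps (\<lambda>\<nu>. if \<nu> = Poly_Mapping.single i 1 then 1 else 0)"

text \<open>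
  Formal infinite sum. It is meaningful when every monomial has a nonzero coefficient in only
  finitely many of the summands.
\<close>

definition mfps_Sum :: "('i \<Rightarrow> 'a::comm_monoid_add mfps) \<Rightarrow> 'i set \<Rightarrow> 'a mfps" where
  "mfps_Sum F I =
     Abs_mfps (\<lambda>\<nu>. \<Sum>i\<in>{i \<in> I. mfps_nth (F i) \<nu> \<noteq> 0}. mfps_nth (F i) \<nu>)"

text \<open>
  The parameters $\<alpha>_i$ and $\<beta>_i$ are only algebraic over the power series ring, so identities
  involving them live in a field (say, an algebraic closure of the fraction field) that contains it.
\<close>

definition ring_embedding :: "('a::ring_1 \<Rightarrow> 'b::ring_1) \<Rightarrow> bool" where
  "ring_embedding \<iota> \<longleftrightarrow>
     \<iota> 1 = 1 \<and> (\<forall>u v. \<iota> (u + v) = \<iota> u + \<iota> v) \<and> (\<forall>u v. \<iota> (u * v) = \<iota> u * \<iota> v) \<and> inj \<iota>"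


section \<open>$q$-analogues\<close>

definition qnum :: "'a::field \<Rightarrow> nat \<Rightarrow> 'a" where
  "qnum q n = (1 - q ^ n) / (1 - q)"

definition qpoch :: "'a::comm_ring_1 \<Rightarrow> 'a \<Rightarrow> nat \<Rightarrow> 'a" where
  "qpoch a q n = (\<Prod>i<n. 1 - a * q ^ i)"

definition qpochs :: "'a::comm_ring_1 list \<Rightarrow> 'a \<Rightarrow> nat \<Rightarrow> 'a" where
  "qpochs as q n = (\<Prod>a\<leftarrow>as. qpoch a q n)"

text \<open>
  The basic hypergeometric series with upper parameters \<open>as\<close>, lower parameters \<open>bs\<close>
  (so \<open>length as = length bs + 1\<close>) and argument $cz$, as a power series in $z$.
\<close>

definition basic_hyp :: "'a::field list \<Rightarrow> 'a list \<Rightarrow> 'a \<Rightarrow> 'a \<Rightarrow> 'a fps" where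
  "basic_hyp as bs q c = Abs_fps (\<lambda>n. qpochs as q n / qpochs (q # bs) q n * c ^ n)"

fun qStirling :: "'a::field \<Rightarrow> nat \<Rightarrow> nat \<Rightarrow> 'a" where
  "qStirling q 0 0 = 1"
| "qStirling q 0 (Suc k) = 0"
| "qStirling q (Suc n) 0 = 0"
| "qStirling q (Suc n) (Suc k) =
     (if k \<le> n then q ^ k * qStirling q n k + qnum q (Suc k) * qStirling q n (Suc k) else 0)"

definition elem_sym :: "nat \<Rightarrow> nat set \<Rightarrow> (nat \<Rightarrow> 'a::comm_ring_1) \<Rightarrow> 'a" where
  "elem_sym j I \<alpha> = (\<Sum>S | S \<subseteq> I \<and> card S = j. \<Prod>i\<in>S. \<alpha> i)"


section \<open>Interpolated $q$-multiple polylogarithms\<close>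

definition Li :: "'a::field \<Rightarrow> nat list \<Rightarrow> 'a fps" where
  "Li q ks = Abs_fps (\<lambda>n.
     \<Sum>ms | length ms = length ks \<and> sorted_wrt (>) ms \<and> (\<forall>m\<in>set ms. m \<ge> 1) \<and> ms \<noteq> [] \<and> hd ms = n.
       1 / (\<Prod>i<length ks. qnum q (ms ! i) ^ (ks ! i)))"

text \<open>All ways of filling each gap of an index with a comma or a plus sign.\<close>

fun fillings :: "nat list \<Rightarrow> nat list list" where
  "fillings [] = [[]]"
| "fillings [k] = [[k]]"
| "fillings (k # k' # ks) = map ((#) k) (fillings (k' # ks)) @ fillings ((k + k') # ks)"

definition Lit :: "'a::field \<Rightarrow> 'a \<Rightarrow> nat list \<Rightarrow> 'a fps" where
  "Lit q t ks = (\<Sum>p\<leftarrow>fillings ks. Li q p * fps_const (t ^ (length ks - length p)))"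

definition height :: "nat \<Rightarrow> nat list \<Rightarrow> nat" where
  "height i ks = card {s. s < length ks \<and> ks ! s \<ge> i + 1}"

text \<open>
  The heights $h_1,\dots,h_r$ are the values of a function \<open>h\<close> at $1,\dots,r$. The condition
  on the first entry excludes the empty index, which only enters through the convention
  in \<open>G_sum\<close>.
\<close>

definition indices :: "nat \<Rightarrow> int \<Rightarrow> nat \<Rightarrow> nat \<Rightarrow> (nat \<Rightarrow> nat) \<Rightarrow> nat list set" where
  "indices r j k l h = {ks. (\<forall>a\<in>set ks. a \<ge> 1) \<and> sum_list ks = k \<and> length ks = l \<and>
     (\<forall>i\<in>{1..r}. height i ks = h i) \<and> ks \<noteq> [] \<and> int (hd ks) \<ge> j + 2}"

definition G_sum ::
  "'a::field \<Rightarrow> 'a \<Rightarrow> nat \<Rightarrow> int \<Rightarrow> nat \<Rightarrow> nat \<Rightarrow> (nat \<Rightarrow> nat) \<Rightarrow> 'a fps" where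
  "G_sum q t r j k l h =
     (if j = -1 \<and> k = 0 \<and> l = 0 \<and> (\<forall>i\<in>{1..r}. h i = 0) then 1
      else (\<Sum>ks\<in>indices r j k l h. Lit q t ks))"

text \<open>
  $x_1^{k-l-\sum_i h_i} x_2^{l-h_1} x_3^{h_1-h_2} \cdots x_{r+1}^{h_{r-1}-h_r} x_{r+2}^{h_r}$.
  The truncated subtractions are harmless: whenever one of the differences is negative, the
  corresponding \<open>G_sum\<close> vanishes.
\<close>

definition height_monomial :: "nat \<Rightarrow> nat \<Rightarrow> nat \<Rightarrow> (nat \<Rightarrow> nat) \<Rightarrow> 'a::comm_ring_1 mfps" where
  "height_monomial r k l h =
     mfps_var 1 ^ (k - l - (\<Sum>i=1..r. h i)) * mfps_var 2 ^ (l - h 1) *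
     (\<Prod>i=1..<r. mfps_var (i + 2) ^ (h i - h (i + 1))) * mfps_var (r + 2) ^ h r"

text \<open>
  The generating function, a power series in $z$ whose coefficients are power series in the $x_i$.
  Heights range over all functions supported on $\{1,\dots,r\}$, that is, over $r$-tuples.
\<close>

definition Phi :: "'a::field \<Rightarrow> 'a \<Rightarrow> nat \<Rightarrow> int \<Rightarrow> 'a mfps fps" where
  "Phi q t r j = Abs_fps (\<lambda>n.
     mfps_Sum (\<lambda>(k, l, h). mfps_const (fps_nth (G_sum q t r j k l h) n) * height_monomial r k l h)
       {(k, l, h). \<forall>i. i \<notin> {1..r} \<longrightarrow> h i = 0})"

definition A_coeff :: "'a::field \<Rightarrow> (nat \<Rightarrow> 'a) \<Rightarrow> nat \<Rightarrow> int \<Rightarrow> nat \<Rightarrow> 'a" where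
  "A_coeff q x r j i =
     (\<Sum>m=i..nat (int r - 1 - j). (x (r + 2 - m) - x 1 * x (r + 1 - m)) * qStirling q (m + 1) (i + 1))
     + x 1 * x (nat (j + 2)) * qStirling q (nat (int r - j)) (i + 1)"

definition hyp_arg :: "'a::field \<Rightarrow> (nat \<Rightarrow> 'a) \<Rightarrow> (nat \<Rightarrow> 'a) \<Rightarrow> nat \<Rightarrow> 'a" where
  "hyp_arg q a b r = (\<Prod>i=1..r+1. b i) / (q ^ (r + 1) * (\<Prod>i=1..r+1. a i))"

definition B_coeff :: "'a::field \<Rightarrow> (nat \<Rightarrow> 'a) \<Rightarrow> (nat \<Rightarrow> 'a) \<Rightarrow> nat \<Rightarrow> nat \<Rightarrow> 'a" where
  "B_coeff q a b r i =
     qpochs (q # map a [1..<r+2]) q i / qpochs (map b [1..<r+2]) q i *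
     ((\<Prod>s=1..r+1. b s) / (q ^ (r + 1) * (1 - q) * (\<Prod>s=1..r+1. a s))) ^ i"

end

theory Submission imports Defs begin

text \<open>
  Write $[n]$ for the $q$-number. Peeling off the first entry of an index shows that the
  coefficient $u_n$ of $z^n$ in the interpolated polylogarithm satisfies
  $u_n(k, \mathbf k) = [n]^{-k} (\sum_{m<n} u_m(\mathbf k) + t\,u_n(\mathbf k))$. After summation over all
  indices with their monomials this becomes, with
  $W = \sum_k w_k [n]^{-k}$ the generating series of a single entry and $W_j$ its part with $k \ge j+2$,
  \[ \Phi_j[n] = \frac{W_j(n)}{1 - t W(n)} \prod_{m<n} \frac{1 + (1-t) W(m)}{1 - t W(m)}. \]
  The series $W$ is geometric from $k = r+1$ on, so multiplication by $1 - x_1/[n]$ turns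
  $1 + (1-t)W$ and $1 - tW$ into the polynomials $\prod_i (1 + \alpha_i/[n])$ and
  $\prod_i (1 + \beta_i/[n])$, whose products over $m$ are the $q$-Pochhammer symbols, and
  turns $[n]^{r+1} W_j$ into a polynomial in $[n]$, which the numbers $S_q$ expand in the
  falling factorials $[n-1]\cdots[n-i]$.
\<close>

section \<open>Generating series weighted by monomials\<close>

definition mfps_monom :: "(nat \<Rightarrow>\<^sub>0 nat) \<Rightarrow> 'a::zero_neq_one mfps" where
  "mfps_monom \<mu> = Abs_mfps (\<lambda>\<nu>. if \<nu> = \<mu> then 1 else 0)"

text \<open>The formal sum of \<open>f p\<close> times the monomial with exponent
  \<open>e p\<close>, given coefficientwise. Splitting it over a union of index sets needs finite
  fibres of \<open>e\<close>, because a sum over an infinite set has the value 0.\<close>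

definition gen_series :: "('i \<Rightarrow> (nat \<Rightarrow>\<^sub>0 nat)) \<Rightarrow> 'i set \<Rightarrow> ('i \<Rightarrow> 'a::comm_monoid_add) \<Rightarrow> 'a mfps" where
  "gen_series e P f = Abs_mfps (\<lambda>\<nu>. \<Sum>p | p \<in> P \<and> e p = \<nu>. f p)"

lemma mfps_nth_basic [simp]:
  "mfps_nth 0 \<nu> = 0"
  "mfps_nth 1 \<nu> = (if \<nu> = 0 then 1 else 0)"
  "mfps_nth (f + g) \<nu> = mfps_nth f \<nu> + mfps_nth g \<nu>"
  "mfps_nth (f - g) \<nu> = mfps_nth f \<nu> - mfps_nth g \<nu>"
  "mfps_nth (mfps_const c) \<nu> = (if \<nu> = 0 then c else 0)"
  "mfps_nth (mfps_monom \<mu>) \<nu> = (if \<nu> = \<mu> then 1 else 0)"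
  by (simp_all add: zero_mfps_def one_mfps_def plus_mfps_def minus_mfps_def
      mfps_const_def mfps_monom_def)

lemma mfps_nth_gen_series: "mfps_nth (gen_series e P f) \<nu> = (\<Sum>p | p \<in> P \<and> e p = \<nu>. f p)"
  by (simp add: gen_series_def)

lemma mfps_nth_monom_mult:
  "mfps_nth (mfps_monom \<mu> * f) (\<mu> + \<rho>) = mfps_nth f \<rho>"
proof -
  have "mfps_nth (mfps_monom \<mu> * f) (\<mu> + \<rho>) =
      (\<Sum>p\<in>splits (\<mu> + \<rho>). if p = (\<mu>, \<rho>) then mfps_nth f \<rho> else 0)"
    unfolding times_mfps_def mfps_nth_Abs
    by (rule sum.cong) (auto simp: splits_def split: if_splits)
  also have "\<dots> = mfps_nth f \<rho>"
    using finite_splits[of "\<mu> + \<rho>"] by (subst sum.delta) (auto simp: splits_def)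
  finally show ?thesis .
qed

lemma mfps_nth_monom_mult_eq_0:
  assumes "\<And>\<rho>. \<nu> \<noteq> \<mu> + \<rho>"
  shows "mfps_nth (mfps_monom \<mu> * f) \<nu> = 0"
  unfolding times_mfps_def mfps_nth_Abs
  using assms by (intro sum.neutral) (auto simp: splits_def)

lemma mfps_nth_const_mult: "mfps_nth (mfps_const c * f) \<nu> = c * mfps_nth f \<nu>"
proof -
  have "mfps_nth (mfps_const c * f) \<nu> =
      (\<Sum>p\<in>splits \<nu>. if p = (0, \<nu>) then c * mfps_nth f \<nu> else 0)"
    unfolding times_mfps_def mfps_nth_Abs
    by (rule sum.cong) (auto simp: splits_def split: if_splits)
  also have "\<dots> = c * mfps_nth f \<nu>"
    using finite_splits[of \<nu>] by (subst sum.delta) (auto simp: splits_def)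
  finally show ?thesis .
qed

lemma mfps_nth_mult_0: "mfps_nth (f * g) 0 = mfps_nth f 0 * mfps_nth g 0"
proof -
  have "splits 0 = {(0, 0)}"
    by (auto simp: splits_def poly_mapping_eq_iff fun_eq_iff lookup_add)
  then show ?thesis
    by (simp add: times_mfps_def)
qed

lemma mfps_nth_sum: "mfps_nth (\<Sum>i\<in>A. f i) \<nu> = (\<Sum>i\<in>A. mfps_nth (f i) \<nu>)"
  by (induction A rule: infinite_finite_induct) auto

lemma mfps_var_eq_monom: "mfps_var i = mfps_monom (Poly_Mapping.single i 1)"
  by (simp add: mfps_var_def mfps_monom_def)

lemma mfps_nth_var_0 [simp]: "mfps_nth (mfps_var i) 0 = 0"
proof -
  have "0 \<noteq> Poly_Mapping.single i (1::nat)"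
    by (metis lookup_single_eq lookup_zero zero_neq_one)
  then show ?thesis
    by (simp add: mfps_var_eq_monom)
qed

lemma mfps_monom_0: "mfps_monom 0 = (1 :: 'a::comm_ring_1 mfps)"
  by (rule mfps_eqI) simp

lemma mfps_monom_add:
  "mfps_monom (\<mu> + \<rho>) = (mfps_monom \<mu> * mfps_monom \<rho> :: 'a::comm_ring_1 mfps)"
proof (rule mfps_eqI)
  fix \<nu>
  show "mfps_nth (mfps_monom (\<mu> + \<rho>)) \<nu> =
      mfps_nth (mfps_monom \<mu> * mfps_monom \<rho> :: 'a mfps) \<nu>"
  proof (cases "\<exists>\<sigma>. \<nu> = \<mu> + \<sigma>")
    case True
    then show ?thesis by (auto simp: mfps_nth_monom_mult)
  next
    case False
    then show ?thesis by (subst mfps_nth_monom_mult_eq_0) auto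
  qed
qed

lemma mfps_var_power:
  "mfps_var i ^ n = (mfps_monom (Poly_Mapping.single i n) :: 'a::comm_ring_1 mfps)"
proof (induction n)
  case (Suc n)
  have "Poly_Mapping.single i (Suc n) = Poly_Mapping.single i 1 + Poly_Mapping.single i n"
    by (simp flip: single_add)
  with Suc show ?case
    by (simp only: power_Suc mfps_monom_add mfps_var_eq_monom)
qed (simp add: mfps_monom_0)

lemma mfps_const_1 [simp]: "mfps_const (1 :: 'a::comm_ring_1) = 1"
  by (rule mfps_eqI) simp

lemma mfps_const_add: "mfps_const (c + d :: 'a::comm_ring_1) = mfps_const c + mfps_const d"
  by (rule mfps_eqI) simp

lemma mfps_const_mult: "mfps_const (c * d :: 'a::comm_ring_1) = mfps_const c * mfps_const d"
  by (rule mfps_eqI) (simp add: mfps_nth_const_mult)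

lemma mfps_const_0 [simp]: "mfps_const (0 :: 'a::comm_ring_1) = 0"
  by (rule mfps_eqI) simp

lemma mfps_const_power: "mfps_const (c ^ n :: 'a::comm_ring_1) = mfps_const c ^ n"
  by (induction n) (simp_all add: mfps_const_mult)

text \<open>A monomial factor shifts all exponents; where \<open>\<nu>\<close> is not divisible by
  \<open>\<mu>\<close>, the fibre on the right is empty and the product has coefficient 0.\<close>

lemma monom_mult_gen_series:
  "mfps_monom \<mu> * gen_series e P f = gen_series (\<lambda>p. \<mu> + e p) P f"
proof (rule mfps_eqI)
  fix \<nu>
  show "mfps_nth (mfps_monom \<mu> * gen_series e P f) \<nu> =
      mfps_nth (gen_series (\<lambda>p. \<mu> + e p) P f) \<nu>"
  proof (cases "\<exists>\<rho>. \<nu> = \<mu> + \<rho>")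
    case True
    then show ?thesis
      by (auto simp: mfps_nth_monom_mult mfps_nth_gen_series)
  next
    case False
    then have "{p. p \<in> P \<and> \<mu> + e p = \<nu>} = {}"
      by auto
    then have "mfps_nth (gen_series (\<lambda>p. \<mu> + e p) P f) \<nu> = 0"
      unfolding mfps_nth_gen_series by (simp only: sum.empty)
    with False show ?thesis
      by (subst mfps_nth_monom_mult_eq_0) auto
  qed
qed

lemma const_mult_gen_series:
  "mfps_const c * gen_series e P f = gen_series e P (\<lambda>p. c * f p)"
  by (rule mfps_eqI) (simp add: mfps_nth_const_mult mfps_nth_gen_series sum_distrib_left)

lemma gen_series_add:
  "gen_series e P (\<lambda>p. f p + g p) = gen_series e P f + (gen_series e P g :: 'a::comm_ring_1 mfps)"
  by (rule mfps_eqI) (simp add: mfps_nth_gen_series sum.distrib)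

lemma gen_series_image:
  assumes "inj_on \<phi> P"
  shows "gen_series e (\<phi> ` P) f = gen_series (\<lambda>p. e (\<phi> p)) P (\<lambda>p. f (\<phi> p))"
proof (rule mfps_eqI)
  fix \<nu>
  have "{p \<in> \<phi> ` P. e p = \<nu>} = \<phi> ` {p \<in> P. e (\<phi> p) = \<nu>}"
    by auto
  moreover have "inj_on \<phi> {p \<in> P. e (\<phi> p) = \<nu>}"
    using assms by (rule inj_on_subset) auto
  ultimately show "mfps_nth (gen_series e (\<phi> ` P) f) \<nu> =
      mfps_nth (gen_series (\<lambda>p. e (\<phi> p)) P (\<lambda>p. f (\<phi> p))) \<nu>"
    by (simp add: mfps_nth_gen_series sum.reindex)
qed

lemma gen_series_union:
  assumes "\<And>\<nu>. finite {p \<in> P \<union> P'. e p = \<nu>}" "P \<inter> P' = {}"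
  shows "gen_series e (P \<union> P') f = gen_series e P f + (gen_series e P' f :: 'a::comm_ring_1 mfps)"
proof (rule mfps_eqI)
  fix \<nu>
  have "{p \<in> P \<union> P'. e p = \<nu>} = {p \<in> P. e p = \<nu>} \<union> {p \<in> P'. e p = \<nu>}"
    by auto
  moreover have "finite {p \<in> P. e p = \<nu>}" "finite {p \<in> P'. e p = \<nu>}"
    using assms(1)[of \<nu>] by (auto elim!: finite_subset[rotated])
  ultimately show "mfps_nth (gen_series e (P \<union> P') f) \<nu> =
      mfps_nth (gen_series e P f + gen_series e P' f) \<nu>"
    using assms(2) by (simp add: mfps_nth_gen_series) (subst sum.union_disjoint, auto)
qed

lemma gen_series_cong:
  assumes "\<And>p. p \<in> P \<Longrightarrow> e p = e' p" "\<And>p. p \<in> P \<Longrightarrow> f p = f' p"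
  shows "gen_series e P f = gen_series e' P f'"
  by (rule mfps_eqI) (auto simp: mfps_nth_gen_series assms intro!: sum.cong)

section \<open>Recursion for interpolated polylogarithms\<close>

text \<open>The condition \<open>ms \<noteq> []\<close> in \<open>Li\<close> excludes the empty
  tuple, so the empty index does not get the customary value 1. That value is reinstated in
  \<open>Lit_prefix\<close>.\<close>

lemma Li_Nil [simp]: "Li q [] = 0"
proof -
  have "{ms :: nat list. length ms = length ([] :: nat list) \<and> sorted_wrt (>) ms \<and> (\<forall>m\<in>set ms. m \<ge> 1) \<and>
      ms \<noteq> [] \<and> hd ms = n} = {}" for n
    by auto
  then have "fps_nth (Li q []) n = 0" for n
    unfolding Li_def fps_nth_Abs_fps by (simp only: sum.empty)
  then show ?thesis
    by (simp add: fps_eq_iff)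
qed

lemma Li_nth_0 [simp]: "fps_nth (Li q ks) 0 = 0"
proof -
  have "{ms :: nat list. length ms = length ks \<and> sorted_wrt (>) ms \<and> (\<forall>m\<in>set ms. m \<ge> 1) \<and>
      ms \<noteq> [] \<and> hd ms = 0} = {}"
    using hd_in_set by fastforce
  then show ?thesis
    unfolding Li_def fps_nth_Abs_fps by (simp only: sum.empty)
qed

text \<open>The outermost summation variable is fixed at \<open>n\<close>, and the rest of the tuple
  is empty or starts at some \<open>m < n\<close>.\<close>

lemma Li_Cons_nth:
  assumes "n \<ge> 1"
  shows "fps_nth (Li q (k # ks)) n =
    (if ks = [] then 1 else \<Sum>m<n. fps_nth (Li q ks) m) / qnum q n ^ k"
proof -
  define D :: "nat \<Rightarrow> nat list set" where
    "D m = {ms. length ms = length ks \<and> sorted_wrt (>) ms \<and> (\<forall>m\<in>set ms. m \<ge> 1) \<and>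
       ms \<noteq> [] \<and> hd ms = m}" for m
  define g where "g ms = 1 / (\<Prod>i<length ks. qnum q (ms ! i) ^ (ks ! i))" for ms
  have Li: "fps_nth (Li q ks) m = sum g (D m)" for m
    by (simp add: Li_def D_def g_def)
  define D' where "D' = {ms. length ms = length (k # ks) \<and> sorted_wrt (>) ms \<and>
       (\<forall>m\<in>set ms. m \<ge> 1) \<and> ms \<noteq> [] \<and> hd ms = n}"
  \<comment> \<open>The admissible tails after the entry \<open>n\<close>. For
    \<open>ks = []\<close> every \<open>D m\<close> is empty, so the empty tail is supplied
    separately.\<close>
  define E where "E = (if ks = [] then {[]} else \<Union>m<n. D m)"
  have D': "D' = (#) n ` E"
  proof (intro equalityI subsetI)
    fix ms assume ms: "ms \<in> D'"
    then obtain ms' where ms': "ms = n # ms'"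
      by (auto simp: D'_def neq_Nil_conv)
    have "ms' \<in> E"
    proof (cases ms')
      case Nil
      then show ?thesis using ms ms' by (auto simp: D'_def E_def)
    next
      case (Cons m ms'')
      then have "ms' \<in> D m" "m < n" "ks \<noteq> []"
        using ms ms' by (auto simp: D'_def D_def)
      then show ?thesis by (auto simp: E_def)
    qed
    then show "ms \<in> (#) n ` E" using ms' by auto
  next
    fix ms assume "ms \<in> (#) n ` E"
    then obtain ms' where ms': "ms = n # ms'" "ms' \<in> E" by auto
    show "ms \<in> D'"
    proof (cases ms')
      case Nil
      then show ?thesis using ms' assms
        by (auto simp: D'_def E_def D_def split: if_splits)
    next
      case (Cons m ms'')
      then show ?thesis using ms' assms
        by (fastforce simp: D'_def E_def D_def split: if_splits)
    qed
  qed
  have "fps_nth (Li q (k # ks)) n =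
      (\<Sum>ms\<in>D'. 1 / (\<Prod>i<Suc (length ks). qnum q (ms ! i) ^ ((k # ks) ! i)))"
    by (simp add: Li_def D'_def)
  also have "\<dots> = (\<Sum>ms\<in>E. g ms / qnum q n ^ k)"
    unfolding D' by (subst sum.reindex)
      (auto simp: prod.lessThan_Suc_shift g_def field_simps simp del: prod.lessThan_Suc)
  also have "\<dots> = sum g E / qnum q n ^ k"
    by (simp add: sum_divide_distrib)
  also have "sum g E = (if ks = [] then 1 else \<Sum>m<n. fps_nth (Li q ks) m)"
  proof (cases "ks = []")
    case True
    then show ?thesis by (simp add: E_def g_def)
  next
    case False
    have fin: "finite (D m)" for m
    proof (rule finite_subset)
      show "D m \<subseteq> {ms. set ms \<subseteq> {..m} \<and> length ms = length ks}"
      proof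
        fix ms assume "ms \<in> D m"
        then show "ms \<in> {ms. set ms \<subseteq> {..m} \<and> length ms = length ks}"
          by (cases ms) (auto simp: D_def intro: less_imp_le)
      qed
    qed (simp add: finite_lists_length_eq)
    have "sum g (\<Union>m<n. D m) = (\<Sum>m<n. sum g (D m))"
      by (rule sum.UNION_disjoint) (auto simp: fin, auto simp: D_def)
    with False show ?thesis
      by (simp add: E_def Li)
  qed
  finally show ?thesis .
qed

lemma Li_add_head_nth:
  assumes "n \<ge> 1"
  shows "fps_nth (Li q ((k + k') # ks)) n = fps_nth (Li q (k' # ks)) n / qnum q n ^ k"
  using assms by (simp add: Li_Cons_nth power_add)

lemma length_fillings: "p \<in> set (fillings ks) \<Longrightarrow> length p \<le> length ks"
  by (induction ks arbitrary: p rule: fillings.induct) fastforce+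

lemma fillings_not_Nil: "p \<in> set (fillings (k # ks)) \<Longrightarrow> p \<noteq> []"
  by (induction "k # ks" arbitrary: k ks p rule: fillings.induct) auto

section \<open>Sums over all fillings of an index\<close>

lemma fps_nth_sum_list: "fps_nth (\<Sum>x\<leftarrow>xs. f x) n = (\<Sum>x\<leftarrow>xs. fps_nth (f x) n)"
  by (induction xs) auto

lemma Lit_nth:
  "fps_nth (Lit q t ks) n =
     (\<Sum>p\<leftarrow>fillings ks. fps_nth (Li q p) n * t ^ (length ks - length p))"
  by (simp add: Lit_def fps_nth_sum_list)

lemma Lit_Nil [simp]: "Lit q t [] = 0"
  by (simp add: Lit_def)

lemma Lit_nth_0 [simp]: "fps_nth (Lit q t ks) 0 = 0"
  by (simp add: Lit_nth)

lemma sum_list_mult_const_right: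
  "(\<Sum>x\<leftarrow>xs. f x * (c :: 'a::semiring_0)) = (\<Sum>x\<leftarrow>xs. f x) * c"
  by (induction xs) (simp_all add: distrib_right)

lemma sum_list_sum_swap:
  "(\<Sum>x\<leftarrow>xs. \<Sum>m\<in>A. f x m) = (\<Sum>m\<in>A. \<Sum>x\<leftarrow>xs. (f x m :: 'a::comm_monoid_add))"
  by (induction xs) (simp_all add: sum.distrib)

text \<open>The first gap decides: a comma leaves \<open>k\<close> in front of a filling of the
  rest, a plus adds it to \<open>k'\<close>. The merged index is shorter by one, which costs a
  factor \<open>t\<close>.\<close>

lemma Lit_merge_nth:
  "fps_nth (Lit q t (k # k' # ks)) n =
     (\<Sum>p\<leftarrow>fillings (k' # ks). fps_nth (Li q (k # p)) n * t ^ (length (k' # ks) - length p)) +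
     t * fps_nth (Lit q t ((k + k') # ks)) n"
proof -
  \<comment> \<open>By \<open>length_fillings\<close> the subtraction does not truncate, so the
    exponent of \<open>t\<close> really grows by one.\<close>
  have "(\<Sum>p\<leftarrow>fillings ((k + k') # ks). fps_nth (Li q p) n * t ^ (length (k # k' # ks) - length p)) =
      (\<Sum>p\<leftarrow>fillings ((k + k') # ks). fps_nth (Li q p) n * t ^ (length ((k + k') # ks) - length p) * t)"
    by (intro arg_cong[of _ _ sum_list] map_cong refl)
       (auto dest!: length_fillings simp: Suc_diff_le)
  then show ?thesis
    by (simp add: Lit_nth o_def sum_list_mult_const_right mult.commute[of t]
        del: mult.assoc power_Suc)
qed

text \<open>Raising the first entry of the index raises the first entry of each filling and nothing
  else. The induction needs arbitrary \<open>k'\<close>, since a plus in the first gap replaces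
  \<open>k'\<close> by \<open>k' + k''\<close>.\<close>

lemma Lit_add_head_nth:
  assumes "n \<ge> 1"
  shows "fps_nth (Lit q t ((k + k') # ks)) n = fps_nth (Lit q t (k' # ks)) n / qnum q n ^ k"
proof (induction ks arbitrary: k')
  case Nil
  show ?case
    using assms by (simp add: Lit_nth Li_add_head_nth)
next
  case (Cons k'' ks)
  show ?case
    unfolding Lit_merge_nth add_divide_distrib add.assoc Cons.IH
    using assms
    by (simp add: Li_add_head_nth divide_inverse flip: sum_list_mult_const_right)
       (simp add: mult_ac)
qed

text \<open>The contribution of what follows a comma when the preceding summation variable is
  \<open>n\<close>; the empty index contributes an empty product. \<open>Lit_prefix_Suc\<close>
  holds there too because \<open>Lit q t [] = 0\<close>.\<close>

definition Lit_prefix :: "'a::field \<Rightarrow> 'a \<Rightarrow> nat \<Rightarrow> nat list \<Rightarrow> 'a" where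
  "Lit_prefix q t n ks = (if ks = [] then 1 else \<Sum>m<n. fps_nth (Lit q t ks) m)"

lemma Lit_prefix_Suc:
  "Lit_prefix q t (Suc n) ks = Lit_prefix q t n ks + fps_nth (Lit q t ks) n"
  by (simp add: Lit_prefix_def)

text \<open>A comma in the first gap makes the next variable smaller than \<open>n\<close>, which
  gives the prefix sum; a plus keeps it at \<open>n\<close>, which gives the term with
  \<open>t\<close>.\<close>

lemma Lit_Cons_nth:
  assumes n: "n \<ge> 1"
  shows "fps_nth (Lit q t (k # ks)) n =
    (Lit_prefix q t n ks + t * fps_nth (Lit q t ks) n) / qnum q n ^ k"
proof (cases ks)
  case Nil
  then show ?thesis
    using n by (simp add: Lit_nth Li_Cons_nth Lit_prefix_def)
next
  case (Cons k' ks')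
  have "(\<Sum>p\<leftarrow>fillings (k' # ks'). fps_nth (Li q (k # p)) n * t ^ (length (k' # ks') - length p)) =
    (\<Sum>p\<leftarrow>fillings (k' # ks').
       (\<Sum>m<n. fps_nth (Li q p) m * t ^ (length (k' # ks') - length p)) * inverse (qnum q n ^ k))"
    by (intro arg_cong[of _ _ sum_list] map_cong refl)
       (use n in \<open>auto dest!: fillings_not_Nil simp: Li_Cons_nth sum_distrib_right divide_inverse
         mult_ac\<close>)
  also have "\<dots> = Lit_prefix q t n ks / qnum q n ^ k"
    unfolding sum_list_mult_const_right sum_list_sum_swap
    by (simp add: Lit_prefix_def Cons Lit_nth divide_inverse)
  finally show ?thesis
    using n Cons by (simp add: Lit_merge_nth Lit_add_head_nth add_divide_distrib)
qed

section \<open>Indices and their monomials\<close>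

definition pos_lists :: "nat list set" where
  "pos_lists = {ks. \<forall>a\<in>set ks. a \<ge> 1}"

definition head_ge :: "nat \<Rightarrow> nat list set" where
  "head_ge k = {ks \<in> pos_lists. ks \<noteq> [] \<and> k \<le> hd ks}"

text \<open>The monomial made multiplicative over entries: an entry $k <= r+1$ weighs $x_{k+1}$, a
  larger one $x_{r+2} x_1^{k-r-1}$.\<close>

definition expo :: "nat \<Rightarrow> nat list \<Rightarrow> (nat \<Rightarrow>\<^sub>0 nat)" where
  "expo r ks = (\<Sum>k\<leftarrow>ks. Poly_Mapping.single (min k (r + 1) + 1) 1 + Poly_Mapping.single 1 (k - (r + 1)))"

lemma expo_Nil [simp]: "expo r [] = 0"
  by (simp add: expo_def)

lemma expo_Cons: "expo r (k # ks) =
    Poly_Mapping.single (min k (r + 1) + 1) 1 + Poly_Mapping.single 1 (k - (r + 1)) + expo r ks"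
  by (simp add: expo_def)

lemma length_eq_expo:
  "ks \<in> pos_lists \<Longrightarrow> length ks = (\<Sum>i=2..r+2. Poly_Mapping.lookup (expo r ks) i)"
proof (induction ks)
  case (Cons k ks)
  then have k: "k \<ge> 1" and IH: "length ks = (\<Sum>i=2..r+2. Poly_Mapping.lookup (expo r ks) i)"
    by (auto simp: pos_lists_def)
  have "(\<Sum>i=2..r+2. Poly_Mapping.lookup (expo r (k # ks)) i) =
      (\<Sum>i=2..r+2. (if i = min k (r + 1) + 1 then 1 else 0) + Poly_Mapping.lookup (expo r ks) i)"
    by (intro sum.cong) (auto simp: expo_Cons lookup_add lookup_single when_def)
  also have "\<dots> = 1 + length ks"
    using k by (auto simp: sum.distrib IH)
  finally show ?case by simp
qed simp

lemma entry_le_expo: "a \<in> set ks \<Longrightarrow> a \<le> r + 1 + Poly_Mapping.lookup (expo r ks) 1"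
  by (induction ks) (auto simp: expo_Cons lookup_add)

text \<open>The exponents of $x_2, ..., x_{r+2}$ add up to the length, and the exponent of $x_1$
  bounds the entries.\<close>

lemma finite_expo: "finite {ks \<in> pos_lists. expo r ks = \<nu>}"
proof (rule finite_subset)
  show "{ks \<in> pos_lists. expo r ks = \<nu>} \<subseteq>
      {ks. set ks \<subseteq> {..r + 1 + Poly_Mapping.lookup \<nu> 1} \<and> length ks = (\<Sum>i=2..r+2. Poly_Mapping.lookup \<nu> i)}"
    using entry_le_expo length_eq_expo by blast
qed (simp add: finite_lists_length_eq)

lemma height_eq_filter: "height i ks = length (filter (\<lambda>k. k \<ge> i + 1) ks)"
  by (simp add: height_def length_filter_conv_card)

lemma expo_eq_single_sum:
  assumes "ks \<in> pos_lists"
  shows "expo r ks = Poly_Mapping.single 1 (\<Sum>k\<leftarrow>ks. k - (r + 1)) +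
    (\<Sum>m=1..r+1. Poly_Mapping.single (m + 1) (length (filter (\<lambda>k. min k (r + 1) = m) ks)))"
  using assms
proof (induction ks)
  case (Cons k ks)
  then have k: "k \<ge> 1" and IH: "expo r ks = Poly_Mapping.single 1 (\<Sum>k\<leftarrow>ks. k - (r + 1)) +
    (\<Sum>m=1..r+1. Poly_Mapping.single (m + 1) (length (filter (\<lambda>k. min k (r + 1) = m) ks)))"
    by (auto simp: pos_lists_def)
  have "(\<Sum>m=1..r+1. Poly_Mapping.single (m + 1) (length (filter (\<lambda>k. min k (r + 1) = m) (k # ks)))) =
    (\<Sum>m=1..r+1. (if m = min k (r + 1) then Poly_Mapping.single (m + 1) 1 else 0) +
       Poly_Mapping.single (m + 1) (length (filter (\<lambda>k. min k (r + 1) = m) ks)))"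
    by (intro sum.cong) (auto simp flip: single_add)
  also have "\<dots> = Poly_Mapping.single (min k (r + 1) + 1) 1 +
    (\<Sum>m=1..r+1. Poly_Mapping.single (m + 1) (length (filter (\<lambda>k. min k (r + 1) = m) ks)))"
    using k by (simp add: sum.distrib del: sum.cl_ivl_Suc)
  finally show ?case
    by (simp only: expo_Cons IH) (simp add: single_add add_ac)
qed simp

text \<open>An entry \<open>k\<close> equals \<open>(k - (r + 1)) + 1 + min r (k - 1)\<close>, and
  exactly \<open>min r (k - 1)\<close> of the heights count it.\<close>

lemma sum_list_eq_heights:
  "ks \<in> pos_lists \<Longrightarrow>
    sum_list ks = (\<Sum>k\<leftarrow>ks. k - (r + 1)) + length ks + (\<Sum>i=1..r. height i ks)"
proof (induction ks)
  case (Cons k ks)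
  have "(\<Sum>i=1..r. if i < k then 1 else 0) = card {i \<in> {1..r}. i < k}"
    by (simp add: sum.If_cases Int_def)
  also have "{i \<in> {1..r}. i < k} = {1..min r (k - 1)}"
    using Cons.prems by (auto simp: pos_lists_def)
  finally have *: "(\<Sum>i=1..r. if i < k then 1 else 0) = min r (k - 1)"
    by simp
  have "(\<Sum>i=1..r. height i (k # ks)) =
      (\<Sum>i=1..r. (if i < k then 1 else 0) + height i ks)"
    by (intro sum.cong) (auto simp: height_eq_filter)
  also have "\<dots> = min r (k - 1) + (\<Sum>i=1..r. height i ks)"
    by (simp only: sum.distrib *)
  finally show ?case
    using Cons by (auto simp: pos_lists_def)
qed (simp add: height_eq_filter)

lemma mfps_monom_sum:
  "mfps_monom (\<Sum>i\<in>A. f i) = (\<Prod>i\<in>A. mfps_monom (f i) :: 'a::comm_ring_1 mfps)"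
  by (induction A rule: infinite_finite_induct) (auto simp: mfps_monom_0 mfps_monom_add)

text \<open>The number of entries with \<open>min k (r + 1) = m\<close> is a difference of
  successive heights, the length serving as height 0; for \<open>m = r + 1\<close> it is the last
  height itself.\<close>

lemma height_monomial_eq_monom:
  assumes r: "r \<ge> 1" and ks: "ks \<in> pos_lists" and h: "\<And>i. i \<in> {1..r} \<Longrightarrow> h i = height i ks"
  shows "height_monomial r (sum_list ks) (length ks) h = (mfps_monom (expo r ks) :: 'a::comm_ring_1 mfps)"
proof -
  define c where "c m = length (filter (\<lambda>k. min k (r + 1) = m) ks)" for m
  have 1: "sum_list ks - length ks - (\<Sum>i=1..r. h i) = (\<Sum>k\<leftarrow>ks. k - (r + 1))"
    using sum_list_eq_heights[OF ks, of r] h by simp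
  have "length ks = length (filter (\<lambda>k. k \<ge> 1 + 1) ks) + length (filter (\<lambda>k. min k (r + 1) = 1) ks)"
  proof -
    have "filter (\<lambda>k. min k (r + 1) = 1) ks = filter (\<lambda>k. \<not> 1 + 1 \<le> k) ks"
    proof (rule filter_cong[OF refl])
      fix k assume "k \<in> set ks"
      then have "k \<ge> 1"
        using ks by (simp add: pos_lists_def)
      with r show "(min k (r + 1) = 1) = (\<not> 1 + 1 \<le> k)" by arith
    qed
    then show ?thesis
      by (simp only: sum_length_filter_compl)
  qed
  then have 2: "length ks - h 1 = c 1"
    using h[of 1] r by (simp only: height_eq_filter c_def) simp
  have 3: "h i - h (i + 1) = c (i + 1)" if "i \<in> {1..<r}" for i
  proof -
    have "length (filter (\<lambda>k. k \<ge> i + 1) ks) =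
        length (filter (\<lambda>k. k \<ge> i + 1 + 1) ks) + length (filter (\<lambda>k. min k (r + 1) = i + 1) ks)"
    proof (induction ks)
      case (Cons k ks)
      have "k \<ge> i + 1 \<longleftrightarrow> k \<ge> i + 1 + 1 \<or> min k (r + 1) = i + 1"
        "\<not> (k \<ge> i + 1 + 1 \<and> min k (r + 1) = i + 1)"
        using that by (simp_all, arith+)
      with Cons show ?case by (cases "k \<ge> i + 1 + 1"; cases "min k (r + 1) = i + 1") simp_all
    qed simp
    then show ?thesis
      using h[of i] h[of "i + 1"] that by (simp only: height_eq_filter c_def) simp
  qed
  have 4: "h r = c (r + 1)"
  proof -
    have "filter (\<lambda>k. k \<ge> r + 1) ks = filter (\<lambda>k. min k (r + 1) = r + 1) ks"
      by (rule filter_cong) auto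
    then show ?thesis
      using h[of r] r by (simp only: height_eq_filter c_def) simp
  qed
  have "(\<Sum>m=1..r+1. Poly_Mapping.single (m + 1) (c m)) =
      Poly_Mapping.single 2 (c 1) + (\<Sum>m\<in>{1+1..<r+1}. Poly_Mapping.single (m + 1) (c m)) +
      Poly_Mapping.single (r + 2) (c (r + 1))"
  proof -
    have "{1..r+1} = insert 1 (insert (r + 1) {1+1..<r+1})"
      using r by auto
    then show ?thesis
      using r by (simp add: add_ac numeral_2_eq_2)
  qed
  also have "(\<Sum>m\<in>{1+1..<r+1}. Poly_Mapping.single (m + 1) (c m)) =
      (\<Sum>i\<in>{1..<r}. Poly_Mapping.single (i + 2) (c (i + 1)))"
    by (subst sum.shift_bounds_nat_ivl) simp
  finally have "expo r ks = Poly_Mapping.single 1 (\<Sum>k\<leftarrow>ks. k - (r + 1)) +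
     Poly_Mapping.single 2 (c 1) + (\<Sum>i\<in>{1..<r}. Poly_Mapping.single (i + 2) (c (i + 1))) +
     Poly_Mapping.single (r + 2) (c (r + 1))"
    by (simp only: expo_eq_single_sum[OF ks] flip: c_def add.assoc)
  moreover have "(\<Prod>i\<in>{1..<r}. mfps_monom (Poly_Mapping.single (i + 2) (h i - h (i + 1)))) =
      (\<Prod>i\<in>{1..<r}. mfps_monom (Poly_Mapping.single (i + 2) (c (i + 1))) :: 'a mfps)"
    by (rule prod.cong) (simp_all only: 3)
  ultimately show ?thesis
    unfolding height_monomial_def 1 2 4 mfps_var_power
    by (simp only: mfps_monom_add mfps_monom_sum)
qed

section \<open>Coefficients of the generating function in z\<close>

lemma Phi_nth_0:
  assumes "r \<ge> 1"
  shows "fps_nth (Phi q t r j) 0 = (if j = -1 then 1 else 0)"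
proof (rule mfps_eqI)
  fix \<nu>
  define g where "g = (\<lambda>(k, l, h). mfps_nth
    (mfps_const (fps_nth (G_sum q t r j k l h) 0) * height_monomial r k l h) \<nu>)"
  define I :: "(nat \<times> nat \<times> (nat \<Rightarrow> nat)) set" where
    "I = {(k, l, h). \<forall>i. i \<notin> {1..r} \<longrightarrow> h i = 0}"
  define x0 :: "nat \<times> nat \<times> (nat \<Rightarrow> nat)" where "x0 = (0, 0, \<lambda>_. 0)"
  \<comment> \<open>Polylogarithms have no constant term in z, so only the convention for the zero
    triple survives.\<close>
  have G0: "fps_nth (G_sum q t r j k l h) 0 =
      (if j = -1 \<and> k = 0 \<and> l = 0 \<and> (\<forall>i\<in>{1..r}. h i = 0) then 1 else 0)" for k l h
    by (auto simp: G_sum_def fps_sum_nth)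
  have g: "g x = (if x = x0 \<and> j = -1 \<and> \<nu> = 0 then 1 else 0)" if "x \<in> I" for x
  proof (cases x)
    case (fields k l h)
    have h0: "(\<forall>i\<in>{1..r}. h i = 0) \<longleftrightarrow> h = (\<lambda>_. 0)"
      using that by (auto simp: fields I_def fun_eq_iff)
    have "g x = (if j = -1 \<and> k = 0 \<and> l = 0 \<and> h = (\<lambda>_. 0) then mfps_nth (height_monomial r k l h) \<nu> else 0)"
      unfolding g_def fields prod.case mfps_nth_const_mult G0 h0 by simp
    also have "\<dots> = (if x = x0 \<and> j = -1 \<and> \<nu> = 0 then 1 else 0)"
      by (simp add: fields x0_def height_monomial_def)
    finally show ?thesis .
  qed
  have "x0 \<in> I"
    by (simp add: I_def x0_def)
  then have "x \<in> I \<and> g x \<noteq> 0 \<longleftrightarrow> x = x0 \<and> j = -1 \<and> \<nu> = 0" for x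
    using g[of x] by (auto split: if_splits)
  then have "{x \<in> I. g x \<noteq> 0} = (if j = -1 \<and> \<nu> = 0 then {x0} else {})"
    by auto
  then have "(\<Sum>x\<in>{x \<in> I. g x \<noteq> 0}. g x) = (if j = -1 \<and> \<nu> = 0 then 1 else 0)"
    using g \<open>x0 \<in> I\<close> by auto
  moreover have "mfps_nth (fps_nth (Phi q t r j) 0) \<nu> = (\<Sum>x\<in>{x \<in> I. g x \<noteq> 0}. g x)"
    by (simp add: Phi_def mfps_Sum_def g_def I_def case_prod_unfold)
  ultimately show "mfps_nth (fps_nth (Phi q t r j) 0) \<nu> = mfps_nth (if j = -1 then 1 else 0) \<nu>"
    by simp
qed

text \<open>Summing over triples and then over the indices with these data is one sum over indices,
  grouped by \<open>\<tau>\<close>. For \<open>n \<ge> 1\<close> the convention for the zero triple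
  contributes nothing.\<close>

lemma Phi_nth_pos:
  assumes r: "r \<ge> 1" and j: "j \<ge> -1" and n: "n \<ge> 1"
  shows "fps_nth (Phi q t r j) n =
    gen_series (expo r) (head_ge (nat (j + 2))) (\<lambda>ks. fps_nth (Lit q t ks) n)"
proof (rule mfps_eqI)
  fix \<nu>
  define u where "u ks = fps_nth (Lit q t ks) n" for ks
  define g where "g = (\<lambda>(k, l, h). mfps_nth
    (mfps_const (fps_nth (G_sum q t r j k l h) n) * height_monomial r k l h) \<nu>)"
  define I :: "(nat \<times> nat \<times> (nat \<Rightarrow> nat)) set" where
    "I = {(k, l, h). \<forall>i. i \<notin> {1..r} \<longrightarrow> h i = 0}"
  define \<tau> where
    "\<tau> ks = (sum_list ks, length ks, \<lambda>i. if i \<in> {1..r} then height i ks else 0)" for ks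
  define S where "S = {ks \<in> head_ge (nat (j + 2)). expo r ks = \<nu>}"
  have fin: "finite S"
    by (rule finite_subset[OF _ finite_expo[of r \<nu>]]) (auto simp: S_def head_ge_def)
  have ind: "ks \<in> indices r j k l h \<longleftrightarrow> ks \<in> head_ge (nat (j + 2)) \<and> \<tau> ks = (k, l, h)"
    if "(k, l, h) \<in> I" for k l h ks
    using that by (auto simp: indices_def head_ge_def pos_lists_def \<tau>_def I_def fun_eq_iff)
  have g: "g x = (\<Sum>ks | ks \<in> S \<and> \<tau> ks = x. u ks)" if "x \<in> I" for x
  proof (cases x)
    case (fields k l h)
    then have I: "(k, l, h) \<in> I" using that by simp
    have fin': "finite (indices r j k l h)"
    proof (rule finite_subset)
      show "indices r j k l h \<subseteq> {ks. set ks \<subseteq> {..k} \<and> length ks = l}"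
        by (auto simp: indices_def member_le_sum_list)
    qed (simp add: finite_lists_length_eq)
    have G: "fps_nth (G_sum q t r j k l h) n = (\<Sum>ks\<in>indices r j k l h. u ks)"
    proof (cases "k = 0 \<and> l = 0")
      case True
      then have "indices r j k l h = {}"
        by (auto simp: indices_def)
      with n show ?thesis by (auto simp: G_sum_def)
    qed (auto simp: G_sum_def fps_sum_nth u_def)
    have hm: "height_monomial r k l h = (mfps_monom (expo r ks) :: 'a mfps)"
      if "ks \<in> indices r j k l h" for ks
    proof -
      have "ks \<in> pos_lists" "\<And>i. i \<in> {1..r} \<Longrightarrow> h i = height i ks" "sum_list ks = k" "length ks = l"
        using that by (auto simp: indices_def pos_lists_def)
      then show ?thesis
        using height_monomial_eq_monom[OF r, of ks h] by simp
    qed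
    have "g x = (\<Sum>ks\<in>indices r j k l h. u ks * mfps_nth (height_monomial r k l h) \<nu>)"
      by (simp add: g_def fields mfps_nth_const_mult G sum_distrib_right)
    also have "\<dots> = (\<Sum>ks\<in>indices r j k l h. if expo r ks = \<nu> then u ks else 0)"
      by (intro sum.cong) (auto simp: hm)
    also have "\<dots> = (\<Sum>ks | ks \<in> indices r j k l h \<and> expo r ks = \<nu>. u ks)"
      using fin' by (simp add: sum.inter_filter)
    also have "{ks. ks \<in> indices r j k l h \<and> expo r ks = \<nu>} = {ks. ks \<in> S \<and> \<tau> ks = x}"
      using fields by (auto simp: ind[OF I] S_def)
    finally show ?thesis .
  qed
  have \<tau>I: "\<tau> ks \<in> I" for ks
    by (simp add: \<tau>_def I_def)
  have "mfps_nth (fps_nth (Phi q t r j) n) \<nu> = (\<Sum>x\<in>{x \<in> I. g x \<noteq> 0}. g x)"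
    by (simp add: Phi_def mfps_Sum_def g_def I_def case_prod_unfold)
  \<comment> \<open>\<open>mfps_Sum\<close> keeps only triples with nonzero coefficient. Each of
    them is the value of \<open>\<tau>\<close> at a member of the finite set \<open>S\<close>, so
    passing to the image of \<open>S\<close> adds only zeros.\<close>
  also have "\<dots> = (\<Sum>x\<in>\<tau> ` S. g x)"
  proof (rule sum.mono_neutral_left)
    show "{x \<in> I. g x \<noteq> 0} \<subseteq> \<tau> ` S"
    proof
      fix x assume "x \<in> {x \<in> I. g x \<noteq> 0}"
      then have "(\<Sum>ks | ks \<in> S \<and> \<tau> ks = x. u ks) \<noteq> 0"
        using g[of x] by auto
      then have "{ks. ks \<in> S \<and> \<tau> ks = x} \<noteq> {}"
        by (metis sum.empty)
      then show "x \<in> \<tau> ` S" by auto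
    qed
  qed (use fin \<tau>I in auto)
  also have "\<dots> = (\<Sum>x\<in>\<tau> ` S. \<Sum>ks | ks \<in> S \<and> \<tau> ks = x. u ks)"
    by (intro sum.cong) (auto simp: g \<tau>I)
  also have "\<dots> = (\<Sum>ks\<in>S. u ks)"
    using fin by (rule sum.image_gen[symmetric])
  finally show "mfps_nth (fps_nth (Phi q t r j) n) \<nu> =
      mfps_nth (gen_series (expo r) (head_ge (nat (j + 2))) (\<lambda>ks. fps_nth (Lit q t ks) n)) \<nu>"
    by (simp add: mfps_nth_gen_series S_def u_def)
qed

section \<open>Functional equations\<close>

definition head_series :: "'a::field \<Rightarrow> 'a \<Rightarrow> nat \<Rightarrow> nat \<Rightarrow> nat \<Rightarrow> 'a mfps" where
  "head_series q t r k n = gen_series (expo r) (head_ge k) (\<lambda>ks. fps_nth (Lit q t ks) n)"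

definition prefix_series :: "'a::field \<Rightarrow> 'a \<Rightarrow> nat \<Rightarrow> nat \<Rightarrow> 'a mfps" where
  "prefix_series q t r n = gen_series (expo r) pos_lists (Lit_prefix q t n)"

text \<open>The series of everything that may follow a first entry whose summation variable equals $n$.\<close>

definition tail_series :: "'a::field \<Rightarrow> 'a \<Rightarrow> nat \<Rightarrow> nat \<Rightarrow> 'a mfps" where
  "tail_series q t r n = gen_series (expo r) pos_lists
     (\<lambda>ks. Lit_prefix q t n ks + t * fps_nth (Lit q t ks) n)"

text \<open>Only the empty index is added on the right, and its polylogarithm is 0.\<close>

lemma head_series_1:
  "head_series q t r 1 n = gen_series (expo r) pos_lists (\<lambda>ks. fps_nth (Lit q t ks) n)"
proof (rule mfps_eqI)
  fix \<nu>
  show "mfps_nth (head_series q t r 1 n) \<nu> =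
      mfps_nth (gen_series (expo r) pos_lists (\<lambda>ks. fps_nth (Lit q t ks) n)) \<nu>"
    unfolding head_series_def mfps_nth_gen_series
  proof (rule sum.mono_neutral_left)
    show "\<forall>ks\<in>{ks. ks \<in> pos_lists \<and> expo r ks = \<nu>} - {ks. ks \<in> head_ge 1 \<and> expo r ks = \<nu>}.
        fps_nth (Lit q t ks) n = 0"
    proof
      fix ks
      assume "ks \<in> {ks. ks \<in> pos_lists \<and> expo r ks = \<nu>} - {ks. ks \<in> head_ge 1 \<and> expo r ks = \<nu>}"
      then have "ks = []"
        by (cases ks) (auto simp: head_ge_def pos_lists_def)
      then show "fps_nth (Lit q t ks) n = 0" by simp
    qed
  qed (use finite_expo in \<open>auto simp: head_ge_def\<close>)
qed

lemma tail_series_eq: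
  "tail_series q t r n = prefix_series q t r n + mfps_const t * head_series q t r 1 n"
  unfolding tail_series_def prefix_series_def head_series_1 const_mult_gen_series gen_series_add ..

lemma prefix_series_Suc:
  "prefix_series q t r (Suc n) = prefix_series q t r n + head_series q t r 1 n"
  unfolding prefix_series_def head_series_1 gen_series_add[symmetric]
  by (rule gen_series_cong) (simp_all only: Lit_prefix_Suc)

text \<open>Initial value of the recursion in \<open>n\<close>: the prefix sums reduce to
  \<open>m = 0\<close>, where all coefficients vanish, so only the empty index remains.\<close>

lemma prefix_series_1: "prefix_series q t r 1 = 1"
proof (rule mfps_eqI)
  fix \<nu>
  have "mfps_nth (prefix_series q t r 1) \<nu> =
      (\<Sum>ks | ks \<in> pos_lists \<and> expo r ks = \<nu>. if ks = [] then 1 else 0)"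
    unfolding prefix_series_def mfps_nth_gen_series
    by (rule sum.cong) (auto simp: Lit_prefix_def)
  also have "\<dots> = (if \<nu> = 0 then 1 else 0)"
    by (subst sum.delta) (auto simp: finite_expo, auto simp: pos_lists_def)
  finally show "mfps_nth (prefix_series q t r 1) \<nu> = mfps_nth 1 \<nu>"
    by simp
qed

text \<open>Indices are separated by whether the first entry equals \<open>k\<close>. The bound
  \<open>k \<le> r + 1\<close> keeps $x_1$ out of the weight of that entry.\<close>

lemma head_series_step:
  assumes n: "n \<ge> 1" and k: "1 \<le> k" "k \<le> r + 1"
  shows "head_series q t r k n =
    mfps_const (1 / qnum q n) ^ k * mfps_var (k + 1) * tail_series q t r n +
    head_series q t r (Suc k) n"
proof -
  have split: "head_ge k = (#) k ` pos_lists \<union> head_ge (Suc k)"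
  proof (intro equalityI subsetI)
    fix ks assume "ks \<in> head_ge k"
    then show "ks \<in> (#) k ` pos_lists \<union> head_ge (Suc k)"
      by (cases ks) (auto simp: head_ge_def pos_lists_def)
  qed (use k in \<open>auto simp: head_ge_def pos_lists_def\<close>)
  have "head_series q t r k n =
      gen_series (expo r) ((#) k ` pos_lists) (\<lambda>ks. fps_nth (Lit q t ks) n) +
      head_series q t r (Suc k) n"
    unfolding head_series_def split
  proof (rule gen_series_union)
    fix \<nu>
    have "(#) k ` pos_lists \<union> head_ge (Suc k) \<subseteq> pos_lists"
      unfolding split[symmetric] by (auto simp: head_ge_def)
    then show "finite {p \<in> (#) k ` pos_lists \<union> head_ge (Suc k). expo r p = \<nu>}"
      by (intro finite_subset[OF _ finite_expo[of r \<nu>]]) auto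
  qed (auto simp: head_ge_def)
  also have "gen_series (expo r) ((#) k ` pos_lists) (\<lambda>ks. fps_nth (Lit q t ks) n) =
      gen_series (\<lambda>ks. Poly_Mapping.single (k + 1) 1 + expo r ks) pos_lists
        (\<lambda>ks. (1 / qnum q n) ^ k * (Lit_prefix q t n ks + t * fps_nth (Lit q t ks) n))"
    using k n by (subst gen_series_image)
      (auto intro!: gen_series_cong simp: expo_Cons Lit_Cons_nth power_one_over)
  also have "\<dots> = mfps_const (1 / qnum q n) ^ k * (mfps_var (k + 1) * tail_series q t r n)"
    by (simp add: tail_series_def mfps_var_eq_monom monom_mult_gen_series const_mult_gen_series
        flip: mfps_const_power)
  finally show ?thesis by (simp add: mult.assoc)
qed

text \<open>From \<open>r + 1\<close> on, raising the first entry by one multiplies the monomial by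
  $x_1$ and the coefficient by $1/[n]$. This geometric behaviour closes the recursion over first
  entries.\<close>

lemma head_series_top:
  assumes n: "n \<ge> 1"
  shows "head_series q t r (r + 2) n =
    mfps_var 1 * mfps_const (1 / qnum q n) * head_series q t r (r + 1) n"
proof -
  define \<phi> where "\<phi> ks = Suc (hd ks) # tl ks" for ks
  have "head_ge (r + 2) = \<phi> ` head_ge (r + 1)"
  proof (intro equalityI subsetI)
    fix ks assume ks: "ks \<in> head_ge (r + 2)"
    then obtain k ks' where "ks = k # ks'" "k \<ge> r + 2"
      by (cases ks) (auto simp: head_ge_def)
    with ks have "ks = \<phi> ((k - 1) # ks')" "(k - 1) # ks' \<in> head_ge (r + 1)"
      by (auto simp: \<phi>_def head_ge_def pos_lists_def)
    then show "ks \<in> \<phi> ` head_ge (r + 1)" by blast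
  qed (auto simp: \<phi>_def head_ge_def pos_lists_def dest: list.set_sel(2))
  moreover have "inj_on \<phi> (head_ge (r + 1))"
    by (auto simp: inj_on_def \<phi>_def head_ge_def intro: list.expand)
  ultimately have "head_series q t r (r + 2) n =
      gen_series (\<lambda>ks. expo r (\<phi> ks)) (head_ge (r + 1)) (\<lambda>ks. fps_nth (Lit q t (\<phi> ks)) n)"
    by (simp add: head_series_def gen_series_image)
  also have "\<dots> = gen_series (\<lambda>ks. Poly_Mapping.single 1 1 + expo r ks) (head_ge (r + 1))
      (\<lambda>ks. 1 / qnum q n * fps_nth (Lit q t ks) n)"
  proof (rule gen_series_cong)
    fix ks assume "ks \<in> head_ge (r + 1)"
    then obtain k ks' where ks: "ks = k # ks'" "k \<ge> r + 1"
      by (cases ks) (auto simp: head_ge_def)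
    have "Suc k - (r + 1) = 1 + (k - (r + 1))"
      using ks by simp
    then have "Poly_Mapping.single (1::nat) (Suc k - (r + 1)) =
        Poly_Mapping.single 1 1 + Poly_Mapping.single 1 (k - (r + 1))"
      by (simp only: single_add)
    then show "expo r (\<phi> ks) = Poly_Mapping.single 1 1 + expo r ks"
      using ks by (simp only: \<phi>_def expo_Cons list.sel) (simp add: add_ac)
    show "fps_nth (Lit q t (\<phi> ks)) n = 1 / qnum q n * fps_nth (Lit q t ks) n"
      using Lit_add_head_nth[OF n, of q t 1 k ks'] ks by (simp add: \<phi>_def)
  qed
  also have "\<dots> = mfps_var 1 * (mfps_const (1 / qnum q n) * head_series q t r (r + 1) n)"
    by (simp add: head_series_def mfps_var_eq_monom monom_mult_gen_series const_mult_gen_series)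
  finally show ?thesis by (simp add: mult.assoc)
qed

text \<open>With $c = 1/[n]$ and $k = j + 2$ this is $(1 - x_1 c)\,W_j(n)$; the last summand makes up for the term
  $-x_1 x_k c^k$ of the sum, which has no counterpart because $W_j$ starts at $k$.\<close>

definition head_poly :: "nat \<Rightarrow> nat \<Rightarrow> (nat \<Rightarrow> 'a::comm_ring_1) \<Rightarrow> 'a \<Rightarrow> 'a" where
  "head_poly r k x c = (\<Sum>i=k..r+1. (x (i + 1) - x 1 * x i) * c ^ i) + x 1 * x k * c ^ k"

text \<open>Downward induction. At \<open>k = r + 1\<close> the step and the geometric relation form
  a linear equation for one series; below that, both sides change by the same multiple of
  \<open>mfps_var (k + 1)\<close>.\<close>

lemma head_series_eq:
  assumes n: "n \<ge> 1" and k: "1 \<le> k" "k \<le> r + 1"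
  shows "(1 - mfps_var 1 * mfps_const (1 / qnum q n)) * head_series q t r k n =
    tail_series q t r n * head_poly r k mfps_var (mfps_const (1 / qnum q n))"
  using k(2,1)
proof (induction k rule: inc_induct)
  case base
  show ?case
    using head_series_step[OF n, of "r + 1" r q t] head_series_top[OF n, of q t r]
    by (simp add: head_poly_def algebra_simps)
next
  case (step k)
  define c where "c = mfps_const (1 / qnum q n)"
  define D where "D = tail_series q t r n"
  have IH: "(1 - mfps_var 1 * c) * head_series q t r (Suc k) n = D * head_poly r (Suc k) mfps_var c"
    using step by (simp add: c_def D_def)
  have "head_poly r k mfps_var c =
      (1 - mfps_var 1 * c) * (c ^ k * mfps_var (k + 1)) + head_poly r (Suc k) mfps_var c"
    using step by (simp add: head_poly_def sum.atLeast_Suc_atMost algebra_simps)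
  moreover have "head_series q t r k n = c ^ k * mfps_var (k + 1) * D + head_series q t r (Suc k) n"
    unfolding c_def D_def using step n by (intro head_series_step) auto
  ultimately have "(1 - mfps_var 1 * c) * head_series q t r k n = D * head_poly r k mfps_var c"
    using IH by (simp only: distrib_left) (simp only: mult_ac)
  then show ?case by (simp add: c_def D_def)
qed

section \<open>$q$-factorials and $q$-Stirling numbers\<close>

lemma qnum_0 [simp]: "qnum q 0 = 0"
  by (simp add: qnum_def)

lemma qnum_1 [simp]: "q \<noteq> 1 \<Longrightarrow> qnum q (Suc 0) = 1"
  by (simp add: qnum_def)

lemma qnum_add: "q \<noteq> 1 \<Longrightarrow> qnum q (k + n) = qnum q k + q ^ k * qnum q n"
  by (simp add: qnum_def field_simps power_add)

text \<open>For \<open>i > n\<close> the factor \<open>l = n\<close> makes the product vanish, so the truncated subtraction is harmless.\<close>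

definition qfall :: "'a::field \<Rightarrow> nat \<Rightarrow> nat \<Rightarrow> 'a" where
  "qfall q n i = (\<Prod>l<i. qnum q (n - l))"

text \<open>Follows from $[n+1] = [i+1] + q^{i+1} [n-i]$, where $[n-i]$ is the next factor of the
  falling product. The rule mirrors the recursion of \<open>qStirling\<close>.\<close>

lemma qnum_mult_qfall:
  assumes "q \<noteq> 1"
  shows "qnum q (Suc n) * qfall q n i = qnum q (Suc i) * qfall q n i + q ^ Suc i * qfall q n (Suc i)"
proof (cases "i \<le> n")
  case True
  then have "qnum q (Suc n) = qnum q (Suc i) + q ^ Suc i * qnum q (n - i)"
    using qnum_add[OF assms, of "Suc i" "n - i"] by simp
  then show ?thesis
    by (simp add: qfall_def algebra_simps)
next
  case False
  then have "n \<in> {..<i}" "n \<in> {..<Suc i}" by auto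
  then have "qfall q n i = 0" "qfall q n (Suc i) = 0"
    unfolding qfall_def by (auto intro!: prod_zero bexI[of _ n])
  then show ?thesis by simp
qed

lemma qStirling_eq_0: "n < k \<Longrightarrow> qStirling q n k = 0"
  by (induction q n k rule: qStirling.induct) auto

text \<open>The q-analogue of expanding powers in falling factorials. Allowing any bound
  \<open>K \<ge> m\<close> gives all powers in \<open>A_coeff_sum\<close> a common range of
  summation.\<close>

lemma qnum_power_eq_sum:
  assumes "q \<noteq> 1" "m \<le> K"
  shows "qnum q (Suc n) ^ m = (\<Sum>i=0..K. qStirling q (m + 1) (i + 1) * qfall q n i)"
  using assms(2)
proof (induction m arbitrary: K)
  case 0
  have "(\<Sum>i=0..K. qStirling q (0 + 1) (i + 1) * qfall q n i) = (\<Sum>i=0..K. if i = 0 then 1 else 0)"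
    using assms by (intro sum.cong) (auto simp: qfall_def)
  then show ?case by simp
next
  case (Suc m)
  then obtain K' where K: "K = Suc K'" "m \<le> K'"
    by (cases K) auto
  let ?S = "\<lambda>i. qStirling q (m + 1) i"
  have "qnum q (Suc n) ^ Suc m = (\<Sum>i=0..K'. ?S (i + 1) * (qnum q (Suc n) * qfall q n i))"
    using Suc.IH[OF K(2)] by (simp add: sum_distrib_left mult_ac)
  also have "\<dots> = (\<Sum>i=0..K'. qnum q (i + 1) * ?S (i + 1) * qfall q n i) +
      (\<Sum>i=0..K'. q ^ (i + 1) * ?S (i + 1) * qfall q n (i + 1))"
    unfolding qnum_mult_qfall[OF assms(1)] by (simp add: sum.distrib algebra_simps)
  also have "(\<Sum>i=0..K'. qnum q (i + 1) * ?S (i + 1) * qfall q n i) =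
      (\<Sum>i=0..K. qnum q (i + 1) * ?S (i + 1) * qfall q n i)"
    using K qStirling_eq_0[of "m + 1" "K + 1" q] by simp
  \<comment> \<open>After the shift a term \<open>i = 0\<close> appears; it vanishes because
    $S_q(m+1, 0) = 0$.\<close>
  also have "(\<Sum>i=0..K'. q ^ (i + 1) * ?S (i + 1) * qfall q n (i + 1)) =
      (\<Sum>i=0..K. q ^ i * ?S i * qfall q n i)"
    unfolding K by (simp only: sum.atLeast0_atMost_Suc_shift) simp
  also have "(\<Sum>i=0..K. qnum q (i + 1) * ?S (i + 1) * qfall q n i) +
      (\<Sum>i=0..K. q ^ i * ?S i * qfall q n i) =
      (\<Sum>i=0..K. qStirling q (Suc m + 1) (i + 1) * qfall q n i)"
    unfolding sum.distrib[symmetric]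
    by (intro sum.cong refl) (auto simp: algebra_simps qStirling_eq_0)
  finally show ?case .
qed

section \<open>Splitting q-Pochhammer symbols and the hypergeometric coefficients\<close>

lemma prod_shifted_interval:
  fixes f :: "nat \<Rightarrow> 'a::comm_monoid_mult"
  shows "(\<Prod>l<i + s. f l) = (\<Prod>l<i. f l) * (\<Prod>l<s. f (i + l))"
  by (induction s) (simp_all add: mult.assoc)

lemma qpoch_add: "qpoch a q (i + s) = qpoch a q i * qpoch (a * q ^ i) q s"
  by (simp add: qpoch_def prod_shifted_interval power_add mult.assoc)

lemma qpoch_self_eq:
  assumes q: "\<And>n. n \<ge> 1 \<Longrightarrow> q ^ n \<noteq> (1::'a::field)" and "i \<le> n"
  shows "qpoch q q n = qpoch q q (n - i) * (1 - q) ^ i * qfall q n i"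
  using assms(2)
proof (induction i)
  case 0
  then show ?case by (simp add: qfall_def)
next
  case (Suc i)
  have q1: "q \<noteq> 1"
    using q[of 1] by simp
  have "qpoch q q (n - i) = qpoch q q (n - Suc i) * (1 - q ^ (n - i))"
    using Suc.prems by (simp add: qpoch_def Suc_diff_Suc[symmetric] del: power_Suc) simp
  also have "1 - q ^ (n - i) = (1 - q) * qnum q (n - i)"
    using q1 by (simp add: qnum_def)
  finally show ?case
    using Suc by (simp add: qfall_def mult_ac)
qed

lemma qpoch_self_nonzero:
  assumes "\<And>n. n \<ge> 1 \<Longrightarrow> q ^ n \<noteq> (1::'a::field)"
  shows "qpoch q q n \<noteq> 0"
  unfolding qpoch_def using assms[of "Suc _"] by (auto simp flip: power_Suc)

lemma qpochs_map_add:
  "qpochs (map a is) q (i + s) = qpochs (map a is) q i * qpochs (map (\<lambda>l. a l * q ^ i) is) q s"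
  by (induction "is") (simp_all add: qpochs_def qpoch_add mult_ac)

lemma qpochs_map_upt: "qpochs (map a [1..<r+2]) q n = (\<Prod>s=1..r+1. qpoch (a s) q n)"
proof -
  have "set [1..<r+2] = {1..r+1}" by auto
  then show ?thesis
    by (simp only: qpochs_def map_map o_def prod.distinct_set_conv_list[symmetric] distinct_upt)
qed

text \<open>The symbols with parameters shifted by $q^i$ continue those in \<open>B_coeff\<close> to
  length \<open>n\<close>. The remaining symbols to base q combine to $(1-q)^i$ times
  \<open>qfall q n i\<close>, and the power of $1-q$ cancels against the one in
  \<open>B_coeff\<close>. Thus only \<open>qfall\<close> still depends on \<open>i\<close>.\<close>

lemma B_coeff_basic_hyp:
  fixes q :: "'a::field"
  assumes q: "\<And>n. n \<ge> 1 \<Longrightarrow> q ^ n \<noteq> 1" and i: "i \<le> n"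
  shows "B_coeff q a b r i *
      fps_nth (basic_hyp (q ^ (i + 1) # map (\<lambda>s. a s * q ^ i) [1..<r+2])
        (map (\<lambda>s. b s * q ^ i) [1..<r+2]) q (hyp_arg q a b r)) (n - i) =
    (\<Prod>s=1..r+1. qpoch (a s) q n) / (\<Prod>s=1..r+1. qpoch (b s) q n) * hyp_arg q a b r ^ n * qfall q n i"
proof -
  define s where "s = n - i"
  have n: "n = i + s"
    using i by (simp add: s_def)
  define C where "C = hyp_arg q a b r"
  have q1: "1 - q \<noteq> 0"
    using q[of 1] by simp
  have C: "(\<Prod>s=1..r+1. b s) / (q ^ (r + 1) * (1 - q) * (\<Prod>s=1..r+1. a s)) = C / (1 - q)"
    by (simp add: C_def hyp_arg_def mult_ac)
  define A1 A2 B1 B2 where "A1 = qpochs (map a [1..<r+2]) q i"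
    and "A2 = qpochs (map (\<lambda>l. a l * q ^ i) [1..<r+2]) q s"
    and "B1 = qpochs (map b [1..<r+2]) q i"
    and "B2 = qpochs (map (\<lambda>l. b l * q ^ i) [1..<r+2]) q s"
  have A: "(\<Prod>s=1..r+1. qpoch (a s) q n) = A1 * A2" and B: "(\<Prod>s=1..r+1. qpoch (b s) q n) = B1 * B2"
    unfolding qpochs_map_upt[symmetric] n qpochs_map_add A1_def A2_def B1_def B2_def by simp_all
  have "qpoch q q i * qpoch (q * q ^ i) q s = qpoch q q s * (1 - q) ^ i * qfall q n i"
    using qpoch_self_eq[OF q i] by (simp add: n qpoch_add)
  then have q': "qpoch q q i * qpoch (q * q ^ i) q s / (qpoch q q s * (1 - q) ^ i) = qfall q n i"
    using qpoch_self_nonzero[OF q, where n = s] q1 by (simp add: field_simps)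
  have "B_coeff q a b r i * fps_nth (basic_hyp (q ^ (i + 1) # map (\<lambda>s. a s * q ^ i) [1..<r+2])
        (map (\<lambda>s. b s * q ^ i) [1..<r+2]) q (hyp_arg q a b r)) (n - i) =
      qpoch q q i * A1 / B1 * (C / (1 - q)) ^ i * (qpoch (q * q ^ i) q s * A2 / (qpoch q q s * B2) * C ^ s)"
    unfolding B_coeff_def C basic_hyp_def fps_nth_Abs_fps s_def[symmetric] C_def[symmetric]
    by (simp add: qpochs_def A1_def A2_def B1_def B2_def o_def)
  also have "\<dots> = (A1 * A2) / (B1 * B2) * C ^ n *
      (qpoch q q i * qpoch (q * q ^ i) q s / (qpoch q q s * (1 - q) ^ i))"
    by (simp add: n power_add power_mult_distrib power_inverse divide_inverse mult_ac)
  finally show ?thesis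
    unfolding q' A B C_def .
qed

lemma A_coeff_sum:
  assumes q: "q \<noteq> 1" and r: "j \<le> int r - 1"
  shows "(\<Sum>i=0..nat (int r - 1 - j). A_coeff q x r j i * qfall q n i) =
    (\<Sum>m=0..nat (int r - 1 - j). (x (r + 2 - m) - x 1 * x (r + 1 - m)) * qnum q (Suc n) ^ m) +
    x 1 * x (nat (j + 2)) * qnum q (Suc n) ^ nat (int r - 1 - j)"
proof -
  define K where "K = nat (int r - 1 - j)"
  have K: "nat (int r - j) = K + 1"
    using r by (simp add: K_def)
  define y where "y m = x (r + 2 - m) - x 1 * x (r + 1 - m)" for m
  \<comment> \<open>The terms with \<open>m < i\<close> vanish; a range independent of
    \<open>i\<close> allows the sums to be swapped.\<close>
  have "(\<Sum>m=i..K. y m * qStirling q (m + 1) (i + 1)) = (\<Sum>m=0..K. y m * qStirling q (m + 1) (i + 1))" for i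
    by (rule sum.mono_neutral_left) (auto intro!: qStirling_eq_0)
  then have "(\<Sum>i=0..K. A_coeff q x r j i * qfall q n i) =
      (\<Sum>i=0..K. \<Sum>m=0..K. y m * qStirling q (m + 1) (i + 1) * qfall q n i) +
      x 1 * x (nat (j + 2)) * (\<Sum>i=0..K. qStirling q (K + 1) (i + 1) * qfall q n i)"
    unfolding A_coeff_def K K_def[symmetric] y_def[symmetric]
    by (simp add: distrib_right sum.distrib sum_distrib_left sum_distrib_right mult.assoc
        del: qStirling.simps)
  also have "(\<Sum>i=0..K. \<Sum>m=0..K. y m * qStirling q (m + 1) (i + 1) * qfall q n i) =
      (\<Sum>m=0..K. y m * (\<Sum>i=0..K. qStirling q (m + 1) (i + 1) * qfall q n i))"
    by (subst sum.swap) (simp add: sum_distrib_left mult.assoc del: qStirling.simps)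
  also have "\<dots> = (\<Sum>m=0..K. y m * qnum q (Suc n) ^ m)"
    by (intro sum.cong refl) (subst qnum_power_eq_sum[OF q], auto)
  finally show ?thesis
    using qnum_power_eq_sum[OF q order_refl, of n K] by (simp only: y_def K_def)
qed

section \<open>Products over the parameters\<close>

lemma prod_one_plus_eq_elem_sym:
  assumes "finite I"
  shows "(\<Prod>i\<in>I. 1 + \<alpha> i * (c :: 'a::comm_ring_1)) = (\<Sum>m=0..card I. elem_sym m I \<alpha> * c ^ m)"
proof -
  have "(\<Prod>i\<in>I. 1 + \<alpha> i * c) = (\<Sum>S\<in>Pow I. \<Prod>i\<in>S. \<alpha> i * c)"
    using prod_add[OF assms, of "\<lambda>i. \<alpha> i * c" "\<lambda>_. 1"] by (simp add: add.commute)
  also have "\<dots> = (\<Sum>S\<in>Pow I. (\<Prod>i\<in>S. \<alpha> i) * c ^ card S)"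
    by (simp add: prod.distrib)
  also have "\<dots> = (\<Sum>m\<in>{0..card I}. \<Sum>S | S \<in> Pow I \<and> card S = m. (\<Prod>i\<in>S. \<alpha> i) * c ^ card S)"
    using assms by (intro sum.group[symmetric]) (auto intro: card_mono)
  also have "\<dots> = (\<Sum>m=0..card I. elem_sym m I \<alpha> * c ^ m)"
    by (intro sum.cong refl) (simp add: elem_sym_def sum_distrib_right)
  finally show ?thesis .
qed

lemma elem_sym_0: "finite I \<Longrightarrow> elem_sym 0 I \<alpha> = 1"
proof -
  assume "finite I"
  then have "{S. S \<subseteq> I \<and> card S = 0} = {{}}"
    by (auto dest: finite_subset)
  then show ?thesis
    by (simp add: elem_sym_def)
qed

lemma elem_sym_1: "elem_sym 1 I \<alpha> = (\<Sum>i\<in>I. \<alpha> i)"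
proof -
  have "{S. S \<subseteq> I \<and> card S = 1} = (\<lambda>i. {i}) ` I"
    by (auto simp: card_1_singleton_iff)
  then show ?thesis
    by (simp add: elem_sym_def sum.reindex)
qed

text \<open>Degrees 0 and 1 are split off because the sum of the parameters is prescribed by a
  formula of its own.\<close>

lemma prod_one_plus_expand:
  fixes \<alpha> :: "nat \<Rightarrow> 'a::comm_ring_1"
  shows "(\<Prod>i=1..r+1. 1 + \<alpha> i * c) =
    1 + (\<Sum>i=1..r+1. \<alpha> i) * c + (\<Sum>m=2..r+1. elem_sym m {1..r+1} \<alpha> * c ^ m)"
proof -
  have "{0..r+1} = insert 0 (insert 1 {2..r+1})"
    by auto
  then show ?thesis
    by (simp add: prod_one_plus_eq_elem_sym elem_sym_0 elem_sym_1[unfolded One_nat_def] add.assoc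
        del: sum.cl_ivl_Suc prod.cl_ivl_Suc)
qed

text \<open>Substituting $q^{n+1} = 1 - (1-q)[n+1]$ shows that the numerator is $(1-q)([n+1] +
  \<gamma>)$.\<close>

lemma qnum_plus_factor:
  fixes q :: "'a::field"
  assumes q: "\<And>n. n \<ge> 1 \<Longrightarrow> q ^ n \<noteq> 1" and "1 + (1 - q) * \<gamma> \<noteq> 0"
  shows "1 + \<gamma> * (1 / qnum q (Suc n)) =
    (1 + (1 - q) * \<gamma>) * (1 - q / (1 + (1 - q) * \<gamma>) * q ^ n) / ((1 - q) * qnum q (Suc n))"
proof -
  define N where "N = qnum q (Suc n)"
  have q1: "1 - q \<noteq> 0" and N: "N \<noteq> 0" and qN: "q ^ Suc n = 1 - (1 - q) * N"
    using q[of 1] q[of "Suc n"] by (simp_all add: N_def qnum_def)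
  have "(1 + (1 - q) * \<gamma>) * (1 - q / (1 + (1 - q) * \<gamma>) * q ^ n) =
      1 + (1 - q) * \<gamma> - q ^ Suc n"
    using assms(2) by (simp add: field_simps)
  also have "\<dots> = (1 - q) * (N + \<gamma>)"
    unfolding qN by (simp add: algebra_simps)
  finally show ?thesis
    using q1 N by (simp only: N_def[symmetric]) (simp add: field_simps)
qed

text \<open>There is one more denominator than numerators. The first one, at $[1] = 1$, is
  \<open>1 + \<beta>\<close>; the others are shifted by one against the numerators, hence $q^2$ in
  \<open>b\<close> but $q$ in \<open>a\<close>.\<close>

lemma prod_ratio_eq_qpoch:
  fixes q :: "'a::field"
  assumes q: "\<And>n. n \<ge> 1 \<Longrightarrow> q ^ n \<noteq> 1" "q \<noteq> 0"
    and \<alpha>: "1 + (1 - q) * \<alpha> \<noteq> 0" and \<beta>: "1 + (1 - q) * \<beta> \<noteq> 0"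
    and \<beta>': "\<And>n. 1 + \<beta> * (1 / qnum q (Suc n)) \<noteq> 0"
  defines "a \<equiv> q / (1 + (1 - q) * \<alpha>)" and "b \<equiv> q\<^sup>2 / (1 + (1 - q) * \<beta>)"
  shows "(\<Prod>m<n. (1 + \<alpha> * (1 / qnum q (Suc m))) / (1 + \<beta> * (1 / qnum q (Suc m)))) /
      (1 + \<beta> * (1 / qnum q (Suc n))) =
    qnum q (Suc n) / (1 + \<beta>) * (qpoch a q n / qpoch b q n) * (b / (q * a)) ^ n"
proof (induction n)
  case 0
  have "q \<noteq> 1"
    using q(1)[of 1] by simp
  then show ?case by (simp add: qpoch_def)
next
  case (Suc n)
  define N where "N = qnum q (Suc n)"
  define N' where "N' = qnum q (Suc (Suc n))"
  have q1: "1 - q \<noteq> 0"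
    using q(1)[of 1] by simp
  have N: "N \<noteq> 0" "N' \<noteq> 0"
    using q(1)[of "Suc n"] q(1)[of "Suc (Suc n)"] q1 by (simp_all add: N_def N'_def qnum_def)
  have 1: "1 + \<alpha> * (1 / N) = (1 + (1 - q) * \<alpha>) * (1 - a * q ^ n) / ((1 - q) * N)"
    unfolding N_def a_def by (rule qnum_plus_factor[OF q(1) \<alpha>])
  have "q / (1 + (1 - q) * \<beta>) * q ^ Suc n = b * q ^ n"
    by (simp add: b_def power2_eq_square)
  then have 2: "1 + \<beta> * (1 / N') = (1 + (1 - q) * \<beta>) * (1 - b * q ^ n) / ((1 - q) * N')"
    unfolding N'_def using qnum_plus_factor[OF q(1) \<beta>, of "Suc n"] by simp
  \<comment> \<open>Numerator \<open>n\<close> is paired with denominator \<open>n + 1\<close>; the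
    quotients \<open>N' / N\<close> telescope over the induction.\<close>
  have 3: "(1 + \<alpha> * (1 / N)) / (1 + \<beta> * (1 / N')) =
      N' / N * (b / (q * a)) * ((1 - a * q ^ n) / (1 - b * q ^ n))"
    unfolding 1 2 using q1 N q(2) \<alpha> \<beta> by (simp add: a_def b_def power2_eq_square divide_simps)
  have "(\<Prod>m<Suc n. (1 + \<alpha> * (1 / qnum q (Suc m))) / (1 + \<beta> * (1 / qnum q (Suc m)))) /
      (1 + \<beta> * (1 / N')) =
      (\<Prod>m<n. (1 + \<alpha> * (1 / qnum q (Suc m))) / (1 + \<beta> * (1 / qnum q (Suc m)))) / (1 + \<beta> * (1 / N)) *
      ((1 + \<alpha> * (1 / N)) / (1 + \<beta> * (1 / N')))"
    by (simp add: N_def divide_inverse mult_ac)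
  also have "\<dots> = N / (1 + \<beta>) * (qpoch a q n / qpoch b q n) * (b / (q * a)) ^ n *
      (N' / N * (b / (q * a)) * ((1 - a * q ^ n) / (1 - b * q ^ n)))"
    using Suc 3 by (simp only: N_def)
  also have "\<dots> = N' / (1 + \<beta>) * (qpoch a q (Suc n) / qpoch b q (Suc n)) * (b / (q * a)) ^ Suc n"
    using N by (simp add: qpoch_def mult_ac)
  finally show ?case by (simp only: N'_def)
qed

section \<open>Passage to the field containing the parameters\<close>

locale embedding =
  fixes \<iota> :: "'k::field mfps \<Rightarrow> 'l::field"
  assumes ring_embedding: "ring_embedding \<iota>"
begin

abbreviation const :: "'k \<Rightarrow> 'l" where
  "const c \<equiv> \<iota> (mfps_const c)"

abbreviation var :: "nat \<Rightarrow> 'l" where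
  "var i \<equiv> \<iota> (mfps_var i)"

lemma emb_1 [simp]: "\<iota> 1 = 1"
  and emb_add: "\<iota> (u + v) = \<iota> u + \<iota> v"
  and emb_mult: "\<iota> (u * v) = \<iota> u * \<iota> v"
  using ring_embedding by (auto simp: ring_embedding_def)

lemma emb_0 [simp]: "\<iota> 0 = 0"
  using emb_add[of 0 0] by (metis add_0_left add_cancel_left_right)

lemma emb_diff: "\<iota> (u - v) = \<iota> u - \<iota> v"
  using emb_add[of "u - v" v] by simp

lemma emb_sum: "\<iota> (\<Sum>i\<in>A. f i) = (\<Sum>i\<in>A. \<iota> (f i))"
  by (induction A rule: infinite_finite_induct) (simp_all add: emb_add)

lemma emb_power: "\<iota> (u ^ n) = \<iota> u ^ n"
  by (induction n) (simp_all add: emb_mult)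

lemma emb_eq_iff: "\<iota> u = \<iota> v \<longleftrightarrow> u = v"
  using ring_embedding by (auto simp: ring_embedding_def inj_def)

text \<open>By injectivity a nonzero constant term suffices; all parameter-dependent denominators
  are treated this way.\<close>

lemma emb_nonzero: "mfps_nth u 0 \<noteq> 0 \<Longrightarrow> \<iota> u \<noteq> 0"
  using emb_eq_iff[of u 0] by auto

lemma const_eq_iff: "const c = const d \<longleftrightarrow> c = d"
  unfolding emb_eq_iff by (metis mfps_nth_basic(5))

lemma const_add: "const (c + d) = const c + const d"
  by (simp add: mfps_const_add emb_add)

lemma const_diff: "const (c - d) = const c - const d"
  using const_add[of "c - d" d] by simp

lemma const_mult: "const (c * d) = const c * const d"
  by (simp add: mfps_const_mult emb_mult)

lemma const_power: "const (c ^ n) = const c ^ n"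
  by (simp add: mfps_const_power emb_power)

lemma const_divide: "const (c / d) = const c / const d"
proof (cases "d = 0")
  case False
  then have "const (c / d) * const d = const c"
    by (simp flip: const_mult)
  moreover have "const d \<noteq> 0"
    using False const_eq_iff[of d 0] by simp
  ultimately show ?thesis
    by (simp add: field_simps)
qed simp

lemma const_qnum: "const (qnum q n) = qnum (const q) n"
  by (simp add: qnum_def const_divide const_diff const_power)

lemma const_inverse_qnum: "const (1 / qnum q n) = 1 / qnum (const q) n"
  unfolding const_divide const_qnum by simp

lemma emb_head_poly: "\<iota> (head_poly r k mfps_var (mfps_const c)) = head_poly r k var (const c)"
  by (simp add: head_poly_def emb_add emb_sum emb_mult emb_diff emb_power)

lemma mfps_nth_0_head_poly: "k \<ge> 1 \<Longrightarrow> mfps_nth (head_poly r k mfps_var (c :: 'k mfps)) 0 = 0"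
  by (simp add: head_poly_def mfps_nth_sum mfps_nth_mult_0)

text \<open>This is $(1 - x_1/[n])(1 + s W(n))$ for $c = 1/[n]$: the parameters $\alpha_i$ belong to $s = 1 - t$, the $\beta_i$ to
  $s = -t$.\<close>

definition base_series :: "'k \<Rightarrow> nat \<Rightarrow> 'k \<Rightarrow> 'k mfps" where
  "base_series s r c = 1 - mfps_var 1 * mfps_const c + mfps_const s * head_poly r 1 mfps_var (mfps_const c)"

lemma emb_base_series:
  "\<iota> (base_series s r c) = 1 - var 1 * const c + const s * head_poly r 1 var (const c)"
  by (simp add: base_series_def emb_add emb_diff emb_mult emb_head_poly)

lemma emb_base_series_nonzero: "\<iota> (base_series s r c) \<noteq> 0"
  by (rule emb_nonzero) (simp add: base_series_def mfps_nth_mult_0 mfps_nth_0_head_poly)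

text \<open>The hypotheses prescribe exactly the coefficients of the product as a polynomial in
  \<open>c\<close>. Since \<open>c\<close> is arbitrary, it can also be taken as
  \<open>1 - q\<close>, as the denominators of $a_i$ and $b_i$ require.\<close>

lemma prod_roots_eq:
  assumes sum: "(\<Sum>i=1..r+1. \<gamma> i) = const s * var 2 - var 1"
    and sym: "\<And>m. m \<in> {2..r+1} \<Longrightarrow>
      elem_sym m {1..r+1} \<gamma> = const s * (var (m + 1) - var 1 * var m)"
  shows "(\<Prod>i=1..r+1. 1 + \<gamma> i * const c) = \<iota> (base_series s r c)"
proof -
  have "{1..r+1} = insert 1 {2..r+1}"
    by auto
  \<comment> \<open>In degree 1 the correction term of \<open>head_poly\<close> cancels $-x_1 x_1 c$
    and leaves $x_2 c$.\<close>
  then have "head_poly r 1 var (const c) =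
      var 2 * const c + (\<Sum>m=2..r+1. (var (m + 1) - var 1 * var m) * const c ^ m)"
    by (simp add: head_poly_def algebra_simps numeral_2_eq_2 del: sum.cl_ivl_Suc)
  moreover have "(\<Sum>m=2..r+1. elem_sym m {1..r+1} \<gamma> * const c ^ m) =
      const s * (\<Sum>m=2..r+1. (var (m + 1) - var 1 * var m) * const c ^ m)"
    unfolding sum_distrib_left by (intro sum.cong refl) (simp only: sym mult.assoc)
  ultimately show ?thesis
    unfolding prod_one_plus_expand emb_base_series sum by (simp add: algebra_simps del: sum.cl_ivl_Suc)
qed

text \<open>Index \<open>n\<close> stands for the summation variable \<open>n + 1\<close>. The head
  equation turns \<open>D = M + t H\<close> into \<open>D B = E M\<close> and the prefix recursion
  into \<open>M (Suc n) E = D A\<close>; cancelling \<open>E\<close> gives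
  \<open>M (Suc n) / M n = A n / B n\<close>, which iterates to the product.\<close>

lemma emb_head_series:
  fixes q t :: 'k and \<alpha> \<beta> :: "nat \<Rightarrow> 'l"
  assumes k: "1 \<le> k" "k \<le> r + 1"
    and alpha_sum: "(\<Sum>i=1..r+1. \<alpha> i) = const (1 - t) * var 2 - var 1"
    and alpha_sym: "\<And>m. m \<in> {2..r+1} \<Longrightarrow>
      elem_sym m {1..r+1} \<alpha> = const (1 - t) * (var (m + 1) - var 1 * var m)"
    and beta_sum: "(\<Sum>i=1..r+1. \<beta> i) = const (- t) * var 2 - var 1"
    and beta_sym: "\<And>m. m \<in> {2..r+1} \<Longrightarrow>
      elem_sym m {1..r+1} \<beta> = const (- t) * (var (m + 1) - var 1 * var m)"
  defines "c \<equiv> \<lambda>n. 1 / qnum (const q) (Suc n)"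
  defines "A \<equiv> \<lambda>n. \<Prod>i=1..r+1. 1 + \<alpha> i * c n"
    and "B \<equiv> \<lambda>n. \<Prod>i=1..r+1. 1 + \<beta> i * c n"
  shows "\<iota> (head_series q t r k (Suc n)) = head_poly r k var (c n) * ((\<Prod>m<n. A m / B m) / B n)"
proof -
  have c: "c n = const (1 / qnum q (Suc n))" for n
    by (simp add: c_def const_inverse_qnum)
  define H where "H k n = \<iota> (head_series q t r k (Suc n))" for k n
  define M where "M n = \<iota> (prefix_series q t r (Suc n))" for n
  define D where "D n = \<iota> (tail_series q t r (Suc n))" for n
  define E where "E n = 1 - var 1 * c n" for n
  define P where "P k n = head_poly r k var (c n)" for k n
  have A: "A n = \<iota> (base_series (1 - t) r (1 / qnum q (Suc n)))" for n
    unfolding A_def c by (rule prod_roots_eq) (use alpha_sum alpha_sym in auto)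
  have B: "B n = \<iota> (base_series (- t) r (1 / qnum q (Suc n)))" for n
    unfolding B_def c by (rule prod_roots_eq) (use beta_sum beta_sym in auto)
  \<comment> \<open>For \<open>s = 0\<close> the base series is exactly $1 - x_1/[n+1]$.\<close>
  have E_nz: "E n \<noteq> 0" for n
    using emb_base_series_nonzero[of 0 r "1 / qnum q (Suc n)"]
    by (simp add: E_def emb_base_series c)
  have B_nz: "B n \<noteq> 0" for n
    unfolding B by (rule emb_base_series_nonzero)
  have AE: "A n = E n + (1 - const t) * P 1 n" and BE: "B n = E n - const t * P 1 n" for n
    using const_diff[of 1 t] const_diff[of 0 t]
    by (simp_all add: A B E_def P_def emb_base_series c)
  have EH: "E n * H k n = D n * P k n" if "1 \<le> k" "k \<le> r + 1" for k n
    using head_series_eq[of "Suc n" k r q t] that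
    by (simp add: E_def H_def D_def P_def c emb_head_poly flip: emb_mult emb_diff emb_1 emb_head_poly)
  have D: "D n = M n + const t * H 1 n" for n
    by (simp add: D_def tail_series_eq emb_add emb_mult M_def H_def)
  have M_Suc: "M (Suc n) = M n + H 1 n" for n
    by (simp add: M_def H_def prefix_series_Suc[of q t r "Suc n"] emb_add)
  have EH1: "E n * H 1 n = D n * P 1 n" for n
    using EH[of 1 n] by simp
  have DB: "D n * B n = E n * M n" for n
  proof -
    have "D n * B n = E n * D n - const t * (D n * P 1 n)"
      by (simp add: BE algebra_simps)
    also have "\<dots> = E n * (D n - const t * H 1 n)"
      unfolding EH1[symmetric] by (simp add: algebra_simps)
    finally show ?thesis by (simp add: D)
  qed
  have MA: "M (Suc n) * E n = D n * A n" for n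
  proof -
    have "D n * A n = E n * D n + (1 - const t) * (D n * P 1 n)"
      by (simp add: AE algebra_simps)
    also have "\<dots> = E n * (D n + (1 - const t) * H 1 n)"
      unfolding EH1[symmetric] by (simp add: algebra_simps)
    also have "D n + (1 - const t) * H 1 n = M (Suc n)"
      by (simp add: D M_Suc algebra_simps)
    finally show ?thesis by simp
  qed
  have D': "D n = E n * M n / B n" for n
    using DB[of n] B_nz[of n] by (simp add: field_simps)
  have "M (Suc n) = M n * (A n / B n)" for n
    using MA[of n] E_nz[of n] B_nz[of n] unfolding D' by (simp add: field_simps)
  then have M: "M n = (\<Prod>m<n. A m / B m)" for n
    by (induction n) (simp_all add: M_def prefix_series_1[unfolded One_nat_def])
  have "H k n = P k n * (M n / B n)"
    using EH[OF k, of n] E_nz[of n] B_nz[of n] unfolding D' by (simp add: field_simps)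
  then show ?thesis
    by (simp add: H_def P_def M)
qed

end

section \<open>Assembling the formula coefficient by coefficient\<close>

lemma qnum_power_mult_head_poly:
  assumes "k \<ge> 1" "k \<le> r + 1" "(N :: 'a::field) \<noteq> 0"
  shows "N ^ (r + 1) * head_poly r k x (1 / N) =
    (\<Sum>m=0..r+1-k. (x (r + 2 - m) - x 1 * x (r + 1 - m)) * N ^ m) + x 1 * x k * N ^ (r + 1 - k)"
proof -
  have pow: "N ^ (r + 1) * (1 / N) ^ i = N ^ (r + 1 - i)" if "i \<le> r + 1" for i
    using that assms(3) by (simp add: power_diff power_one_over del: power_Suc)
  have pow_mult: "N ^ (r + 1) * (y * (1 / N) ^ i) = y * N ^ (r + 1 - i)" if "i \<le> r + 1" for i y
    using pow[OF that] by (simp only: mult.left_commute)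
  have "N ^ (r + 1) * (\<Sum>i=k..r+1. (x (i + 1) - x 1 * x i) * (1 / N) ^ i) =
      (\<Sum>i=k..r+1. (x (i + 1) - x 1 * x i) * N ^ (r + 1 - i))"
    unfolding sum_distrib_left by (intro sum.cong refl pow_mult) auto
  \<comment> \<open>Reversing the summation brings the polynomial into the form produced by
    \<open>A_coeff_sum\<close>.\<close>
  also have "\<dots> = (\<Sum>m=0..r+1-k. (x (r + 2 - m) - x 1 * x (r + 1 - m)) * N ^ m)"
    by (rule sum.reindex_bij_witness[where i = "\<lambda>m. r + 1 - m" and j = "\<lambda>i. r + 1 - i"])
       (use assms in \<open>auto simp: Suc_diff_le\<close>)
  finally show ?thesis
    unfolding head_poly_def distrib_left pow_mult[OF assms(2)] by simp
qed

theorem theorem3p9: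
  fixes q t :: "'k::field_char_0"
    and \<iota> :: "'k mfps \<Rightarrow> 'l::field"
    and \<alpha> \<beta> a b x :: "nat \<Rightarrow> 'l" and Q T :: 'l
    and r :: nat and j :: int
  assumes q_nonzero: "q \<noteq> 0"
    and q_generic: "\<And>n. n \<ge> 1 \<Longrightarrow> q ^ n \<noteq> 1"
    and extension: "ring_embedding \<iota>"
  defines "x \<equiv> \<lambda>i. \<iota> (mfps_var i)"
    and "Q \<equiv> \<iota> (mfps_const q)"
    and "T \<equiv> \<iota> (mfps_const t)"
  assumes r: "r \<ge> 1"
    and j: "-1 \<le> j" "j \<le> int r - 1"
    and alpha_sum: "(\<Sum>i=1..r+1. \<alpha> i) = (1 - T) * x 2 - x 1"
    and alpha_sym: "\<And>m. m \<in> {2..r+1} \<Longrightarrow>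
          elem_sym m {1..r+1} \<alpha> = (1 - T) * (x (m + 1) - x 1 * x m)"
    and beta_sum: "(\<Sum>i=1..r+1. \<beta> i) = - (x 1 + T * x 2)"
    and beta_sym: "\<And>m. m \<in> {2..r+1} \<Longrightarrow>
          elem_sym m {1..r+1} \<beta> = - T * (x (m + 1) - x 1 * x m)"
  defines "a \<equiv> \<lambda>i. Q / (1 + (1 - Q) * \<alpha> i)"
    and "b \<equiv> \<lambda>i. Q\<^sup>2 / (1 + (1 - Q) * \<beta> i)"
  shows "Abs_fps (\<lambda>n. \<iota> (fps_nth (Phi q t r j) n)) =
    fps_const (1 / (1 - (x 1 + T * x 2) - T * (\<Sum>i=0..r-1. x (r + 2 - i) - x 1 * x (r + 1 - i)))) *
    (\<Sum>i=0..nat (int r - 1 - j).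
       fps_const (A_coeff Q x r j i * B_coeff Q a b r i) * fps_X ^ (i + 1) *
       basic_hyp (Q ^ (i + 1) # map (\<lambda>s. a s * Q ^ i) [1..<r+2])
                 (map (\<lambda>s. b s * Q ^ i) [1..<r+2]) Q (hyp_arg Q a b r))
    + (if j = -1 then 1 else 0)"
proof -
  interpret embedding \<iota>
    by (rule embedding.intro[OF extension])
  have s1: "const (1 - t) = 1 - T" and s2: "const (- t) = - T"
    using const_diff[of 1 t] const_diff[of 0 t] by (simp_all add: T_def)
  have Q0: "Q \<noteq> 0"
    using q_nonzero const_eq_iff[of q 0] by (simp add: Q_def)
  have Q: "Q ^ n \<noteq> 1" if "n \<ge> 1" for n
    using q_generic[OF that] const_eq_iff[of "q ^ n" 1] by (simp add: Q_def const_power)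
  then have Q1: "Q \<noteq> 1"
    using Q[of 1] by simp
  define k where "k = nat (j + 2)"
  have k: "1 \<le> k" "k \<le> r + 1" and K: "r + 1 - k = nat (int r - 1 - j)"
    using j by (auto simp: k_def)
  have as: "(\<Sum>i=1..r+1. \<alpha> i) = const (1 - t) * var 2 - var 1"
    "\<And>m. m \<in> {2..r+1} \<Longrightarrow> elem_sym m {1..r+1} \<alpha> = const (1 - t) * (var (m + 1) - var 1 * var m)"
    using alpha_sum alpha_sym by (simp_all add: s1 x_def)
  have bs: "(\<Sum>i=1..r+1. \<beta> i) = const (- t) * var 2 - var 1"
    "\<And>m. m \<in> {2..r+1} \<Longrightarrow> elem_sym m {1..r+1} \<beta> = const (- t) * (var (m + 1) - var 1 * var m)"
    using beta_sum beta_sym by (simp_all add: s2 x_def)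
  \<comment> \<open>A vanishing factor would annihilate the product, but the base series has
    constant term 1.\<close>
  have nonzero: "1 + \<gamma> i * const c \<noteq> 0" if "i \<in> {1..r+1}"
    "(\<Prod>i=1..r+1. 1 + \<gamma> i * const c) = \<iota> (base_series s r c)" for \<gamma> c s i
    using that emb_base_series_nonzero[of s r c] by (metis finite_atLeastAtMost prod_zero)
  have Q': "1 - Q = const (1 - q)"
    by (simp add: const_diff Q_def)
  \<comment> \<open>\<open>c = 1 - q\<close> handles the denominators of $a_i$ and $b_i$, and $c =
    1/[n+1]$ the factors divided by in the product formula.\<close>
  have \<alpha>_nz: "1 + (1 - Q) * \<alpha> i \<noteq> 0" and \<beta>_nz: "1 + (1 - Q) * \<beta> i \<noteq> 0"
    and \<beta>_nz': "1 + \<beta> i * (1 / qnum Q (Suc n)) \<noteq> 0" if "i \<in> {1..r+1}" for i n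
    using nonzero[OF that prod_roots_eq[OF as], of "1 - q"]
      nonzero[OF that prod_roots_eq[OF bs], of "1 - q"]
      nonzero[OF that prod_roots_eq[OF bs], of "1 / qnum q (Suc n)"]
    unfolding const_inverse_qnum Q'[symmetric] Q_def[symmetric] by (simp_all only: mult.commute not_False_eq_True)
  have "(\<Sum>i=0..r-1. x (r + 2 - i) - x 1 * x (r + 1 - i)) = (\<Sum>m=2..r+1. x (m + 1) - x 1 * x m)"
    by (rule sum.reindex_bij_witness[where i = "\<lambda>m. r + 1 - m" and j = "\<lambda>i. r + 1 - i"])
       (use r in \<open>auto simp: Suc_diff_le\<close>)
  \<comment> \<open>The prefactor is the reciprocal of the \<open>\<beta>\<close> product at
    \<open>c = 1\<close>, the value belonging to $[1]$.\<close>
  moreover have "(\<Prod>i=1..r+1. 1 + \<beta> i * 1) = 1 - (x 1 + T * x 2) - T * (\<Sum>m=2..r+1. x (m + 1) - x 1 * x m)"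
  proof -
    have "(\<Sum>m=2..r+1. elem_sym m {1..r+1} \<beta> * 1 ^ m) = - T * (\<Sum>m=2..r+1. x (m + 1) - x 1 * x m)"
      unfolding sum_distrib_left by (intro sum.cong refl) (simp only: beta_sym power_one mult_1_right)
    then show ?thesis
      unfolding prod_one_plus_expand beta_sum by simp
  qed
  ultimately have pref: "1 - (x 1 + T * x 2) - T * (\<Sum>i=0..r-1. x (r + 2 - i) - x 1 * x (r + 1 - i)) =
      (\<Prod>i=1..r+1. 1 + \<beta> i)"
    by simp
  define F where "F i = basic_hyp (Q ^ (i + 1) # map (\<lambda>s. a s * Q ^ i) [1..<r+2])
                 (map (\<lambda>s. b s * Q ^ i) [1..<r+2]) Q (hyp_arg Q a b r)" for i
  have coeff: "\<iota> (fps_nth (Phi q t r j) (Suc n)) = 1 / (\<Prod>i=1..r+1. 1 + \<beta> i) *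
      (\<Sum>i=0..nat (int r - 1 - j). if n < i then 0 else
        A_coeff Q x r j i * B_coeff Q a b r i * fps_nth (F i) (n - i))" for n
  proof -
    define N where "N = qnum Q (Suc n)"
    have N: "N \<noteq> 0"
      using Q[of "Suc n"] Q1 by (simp add: N_def qnum_def)
    define R where "R = (\<Prod>s=1..r+1. qpoch (a s) Q n) / (\<Prod>s=1..r+1. qpoch (b s) Q n) * hyp_arg Q a b r ^ n"
    have hyp: "hyp_arg Q a b r = (\<Prod>s=1..r+1. b s / (Q * a s))"
      by (simp add: hyp_arg_def prod_dividef prod.distrib del: prod.cl_ivl_Suc)
    \<comment> \<open>Interchanging the two products lets \<open>prod_ratio_eq_qpoch\<close> act on
      each pair of parameters separately.\<close>
    have "(\<Prod>m<n. (\<Prod>i=1..r+1. 1 + \<alpha> i * (1 / qnum Q (Suc m))) / (\<Prod>i=1..r+1. 1 + \<beta> i * (1 / qnum Q (Suc m)))) /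
        (\<Prod>i=1..r+1. 1 + \<beta> i * (1 / N)) =
        (\<Prod>i=1..r+1. (\<Prod>m<n. (1 + \<alpha> i * (1 / qnum Q (Suc m))) / (1 + \<beta> i * (1 / qnum Q (Suc m)))) /
          (1 + \<beta> i * (1 / N)))"
      unfolding prod_dividef[symmetric] by (subst prod.swap) (rule prod_dividef[symmetric])
    also have "\<dots> = (\<Prod>i=1..r+1. N / (1 + \<beta> i) * (qpoch (a i) Q n / qpoch (b i) Q n) * (b i / (Q * a i)) ^ n)"
      unfolding N_def a_def b_def
      by (intro prod.cong refl prod_ratio_eq_qpoch Q Q0 \<alpha>_nz \<beta>_nz \<beta>_nz')
    also have "\<dots> = N ^ (r + 1) / (\<Prod>i=1..r+1. 1 + \<beta> i) * R"
      unfolding R_def hyp prod_power_distrib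
      by (simp add: prod.distrib prod_dividef del: prod.cl_ivl_Suc)
    finally have ratio: "(\<Prod>m<n. (\<Prod>i=1..r+1. 1 + \<alpha> i * (1 / qnum Q (Suc m))) / (\<Prod>i=1..r+1. 1 + \<beta> i * (1 / qnum Q (Suc m)))) /
        (\<Prod>i=1..r+1. 1 + \<beta> i * (1 / N)) = N ^ (r + 1) / (\<Prod>i=1..r+1. 1 + \<beta> i) * R" .
    have "\<iota> (fps_nth (Phi q t r j) (Suc n)) = \<iota> (head_series q t r k (Suc n))"
      using j r by (simp add: Phi_nth_pos head_series_def k_def)
    also have "\<dots> = head_poly r k x (1 / N) * (N ^ (r + 1) / (\<Prod>i=1..r+1. 1 + \<beta> i) * R)"
      using emb_head_series[OF k as bs, of q n] ratio by (simp only: N_def Q_def x_def)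
    also have "\<dots> = 1 / (\<Prod>i=1..r+1. 1 + \<beta> i) * R * (N ^ (r + 1) * head_poly r k x (1 / N))"
      by simp
    also have "N ^ (r + 1) * head_poly r k x (1 / N) =
        (\<Sum>i=0..nat (int r - 1 - j). A_coeff Q x r j i * qfall Q n i)"
      unfolding A_coeff_sum[OF Q1 j(2)] qnum_power_mult_head_poly[OF k N] K by (simp add: k_def N_def)
    also have "1 / (\<Prod>i=1..r+1. 1 + \<beta> i) * R * \<dots> = 1 / (\<Prod>i=1..r+1. 1 + \<beta> i) *
        (\<Sum>i=0..nat (int r - 1 - j). A_coeff Q x r j i * (R * qfall Q n i))"
      by (simp add: sum_distrib_left mult_ac)
    also have "(\<Sum>i=0..nat (int r - 1 - j). A_coeff Q x r j i * (R * qfall Q n i)) =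
        (\<Sum>i=0..nat (int r - 1 - j). if n < i then 0 else
          A_coeff Q x r j i * B_coeff Q a b r i * fps_nth (F i) (n - i))"
    proof (intro sum.cong refl)
      fix i
      show "A_coeff Q x r j i * (R * qfall Q n i) = (if n < i then 0 else
          A_coeff Q x r j i * B_coeff Q a b r i * fps_nth (F i) (n - i))"
      proof (cases "n < i")
        case True
        \<comment> \<open>The factor $[n-n] = [0]$ occurs, in agreement with the summand being
          divisible by $z^{i+1}$.\<close>
        then have "qfall Q n i = 0"
          unfolding qfall_def by (auto intro!: prod_zero bexI[of _ n])
        with True show ?thesis by simp
      next
        case False
        then have "B_coeff Q a b r i * fps_nth (F i) (n - i) = R * qfall Q n i"
          unfolding F_def R_def by (intro B_coeff_basic_hyp Q) auto
        with False show ?thesis by (simp add: mult.assoc)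
      qed
    qed
    finally show ?thesis .
  qed
  show ?thesis
    unfolding pref F_def[symmetric]
  proof (rule fps_ext)
    fix n
    show "fps_nth (Abs_fps (\<lambda>n. \<iota> (fps_nth (Phi q t r j) n))) n =
      fps_nth (fps_const (1 / (\<Prod>i=1..r+1. 1 + \<beta> i)) *
        (\<Sum>i=0..nat (int r - 1 - j). fps_const (A_coeff Q x r j i * B_coeff Q a b r i) *
           fps_X ^ (i + 1) * F i) + (if j = -1 then 1 else 0)) n"
    proof (cases n)
      case 0
      \<comment> \<open>Every hypergeometric summand is divisible by z, so the constant term comes
        from the Kronecker delta alone.\<close>
      have "fps_nth (if j = -1 then 1 else 0 :: 'l fps) 0 = (if j = -1 then 1 else 0)"
        by simp
      then show ?thesis
        using r 0 by (simp add: Phi_nth_0 fps_sum_nth fps_X_power_mult_nth mult.assoc del: power_Suc)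
    next
      case (Suc n')
      have nth: "fps_nth (fps_const c * fps_X ^ (i + 1) * F i) (Suc n') =
          (if n' < i then 0 else c * fps_nth (F i) (n' - i))" for c i
        by (simp add: fps_X_power_mult_nth mult.assoc del: power_Suc)
      have "fps_nth (if j = -1 then 1 else 0 :: 'l fps) (Suc n') = 0"
        by simp
      then show ?thesis
        unfolding Suc fps_nth_Abs_fps coeff fps_add_nth fps_mult_left_const_nth fps_sum_nth nth
        by simp
    qed
  qed
qed

end
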